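(* There exists a single-pass data stream algorithm using $O(1)$ words of working memory that, given $k$ and $\epsilon\in(0,1)$, processes a stream of $O(k\log^4(1/\epsilon)/\epsilon^2)$ i.i.d. samples from an unknown distribution $\mathcal D$ on $[k]=\{1,\dots,k\}$ and returns an additive $\epsilon$ approximation of $H(\mathcal D)$ (i.e., a number $\hat H$ with $|\hat H-H(\mathcal D)|\le\epsilon$) with probability at least $2/3$.
   Context: For a distribution $\mathcal D$ on $[k]$ with probabilities $p_1,\dots,p_k$, its (Shannon) entropy is $H(\mathcal D)=\sum_{i=1}^k p_i\log(1/p_i)$, with logarithms base $2$. A "word" of memory is a unit holding $\Theta(\log(k/\epsilon))$ bits (enough to store the name of an element of $[k]$ and the value of $\epsilon$).
   Formalization: In the sample bound O(k log^4(1/ε)/ε^2), log(1/ε) is read as max(1, log(1/ε)); otherwise the bound tends to 0 samples as ε→1 and the claim fails, e.g. for k=4. For ε ≤ 1/2 the bound is the literal one. *)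

theory Defs
  imports "HOL-Probability.Probability"
begin

text \<open>
  Shannon entropy in bits of a distribution on \<open>{1..k}\<close>.  A point of probability zero
  contributes \<open>0 * log 2 (1 / 0) = 0\<close>, the usual convention.
\<close>

definition shannon_entropy :: "nat \<Rightarrow> nat pmf \<Rightarrow> real" where
  "shannon_entropy k D = (\<Sum>i = 1..k. pmf D i * log 2 (1 / pmf D i))"

text \<open>
  Single-pass data stream algorithms are programs for a word machine.  The working memory is the
  set of registers that occur in the program; a program is a finite term, so this is a constant
  number of registers, and every register always holds a word of \<open>w\<close> bits, i.e. a natural number
  below \<open>2 ^ w\<close>.  All arithmetic, including that of intermediate results inside an
  expression, is performed on words.  There are no other data structures; the stream can only be
  accessed by taking its next element.
\<close>

datatype aexp =
    Const nat
  | Reg nat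
  | Plus aexp aexp
  | Minus aexp aexp
  | Times aexp aexp
  | Quot aexp aexp
  | Rem aexp aexp
  | Less aexp aexp

datatype com =
    Skip
  | Assign nat aexp
  | Next nat
  | Coin nat
  | Seq com com
  | Cond aexp com com
  | While aexp com

fun aexp_registers :: "aexp \<Rightarrow> nat set" where
  "aexp_registers (Const n) = {}"
| "aexp_registers (Reg r) = {r}"
| "aexp_registers (Plus a b) = aexp_registers a \<union> aexp_registers b"
| "aexp_registers (Minus a b) = aexp_registers a \<union> aexp_registers b"
| "aexp_registers (Times a b) = aexp_registers a \<union> aexp_registers b"
| "aexp_registers (Quot a b) = aexp_registers a \<union> aexp_registers b"
| "aexp_registers (Rem a b) = aexp_registers a \<union> aexp_registers b"
| "aexp_registers (Less a b) = aexp_registers a \<union> aexp_registers b"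

fun com_registers :: "com \<Rightarrow> nat set" where
  "com_registers Skip = {}"
| "com_registers (Assign r a) = insert r (aexp_registers a)"
| "com_registers (Next r) = {r}"
| "com_registers (Coin r) = {r}"
| "com_registers (Seq P Q) = com_registers P \<union> com_registers Q"
| "com_registers (Cond a P Q) = aexp_registers a \<union> com_registers P \<union> com_registers Q"
| "com_registers (While a P) = aexp_registers a \<union> com_registers P"

text \<open>Registers 0 and 1 carry the input and the output, see below.\<close>

definition working_memory :: "com \<Rightarrow> nat set" where
  "working_memory P = {0, 1} \<union> com_registers P"

definition word :: "nat \<Rightarrow> nat \<Rightarrow> nat" where
  "word w v = v mod 2 ^ w"

text \<open>Subtraction is truncated at 0; division by 0 yields 0.\<close>

fun aval :: "nat \<Rightarrow> (nat \<Rightarrow> nat) \<Rightarrow> aexp \<Rightarrow> nat" where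
  "aval w s (Const n) = word w n"
| "aval w s (Reg r) = s r"
| "aval w s (Plus a b) = word w (aval w s a + aval w s b)"
| "aval w s (Minus a b) = word w (aval w s a - aval w s b)"
| "aval w s (Times a b) = word w (aval w s a * aval w s b)"
| "aval w s (Quot a b) = word w (aval w s a div aval w s b)"
| "aval w s (Rem a b) = word w (aval w s a mod aval w s b)"
| "aval w s (Less a b) = word w (of_bool (aval w s a < aval w s b))"

text \<open>
  A configuration \<open>(s, xs, cs)\<close> consists of the registers, the part of the stream that has not been
  read yet, and the fair coin flips that have not been used yet.  \<open>exec w P c c'\<close> states
  that \<open>P\<close>, started in \<open>c\<close>, terminates in \<open>c'\<close>.  It is deterministic, and there is no \<open>c'\<close> if
  \<open>P\<close> diverges or asks for an element of an exhausted stream.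
\<close>

type_synonym config = "(nat \<Rightarrow> nat) \<times> nat list \<times> bool list"

inductive exec :: "nat \<Rightarrow> com \<Rightarrow> config \<Rightarrow> config \<Rightarrow> bool" for w :: nat where
  Skip: "exec w Skip c c"
| Assign: "exec w (Assign r a) (s, xs, cs) (s(r := aval w s a), xs, cs)"
| Next: "exec w (Next r) (s, x # xs, cs) (s(r := word w x), xs, cs)"
| Coin: "exec w (Coin r) (s, xs, c # cs) (s(r := word w (of_bool c)), xs, cs)"
| Seq: "exec w P c c' \<Longrightarrow> exec w Q c' c'' \<Longrightarrow> exec w (Seq P Q) c c''"
| CondTrue: "aval w (fst c) a \<noteq> 0 \<Longrightarrow> exec w P c c' \<Longrightarrow> exec w (Cond a P Q) c c'"
| CondFalse: "aval w (fst c) a = 0 \<Longrightarrow> exec w Q c c' \<Longrightarrow> exec w (Cond a P Q) c c'"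
| WhileFalse: "aval w (fst c) a = 0 \<Longrightarrow> exec w (While a P) c c"
| WhileTrue: "aval w (fst c) a \<noteq> 0 \<Longrightarrow> exec w P c c' \<Longrightarrow> exec w (While a P) c' c'' \<Longrightarrow>
    exec w (While a P) c c''"

text \<open>
  The input \<open>k\<close> is given in register 0.  The real number \<open>\<epsilon>\<close> is given in register 1 through the
  integer \<open>\<lceil>1/\<epsilon>\<rceil>\<close>, i.e. as the accuracy \<open>1/\<lceil>1/\<epsilon>\<rceil>\<close>, which lies between \<open>\<epsilon>/2\<close> and \<open>\<epsilon>\<close>.
\<close>

definition initial_registers :: "nat \<Rightarrow> nat \<Rightarrow> real \<Rightarrow> nat \<Rightarrow> nat" where
  "initial_registers w k \<epsilon> = (\<lambda>_. 0)(0 := word w k, 1 := word w (nat \<lceil>1 / \<epsilon>\<rceil>))"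

text \<open>The returned number is the quotient of the final contents of registers 0 and 1.\<close>

definition returns :: "nat \<Rightarrow> com \<Rightarrow> nat \<Rightarrow> real \<Rightarrow> nat list \<Rightarrow> bool list \<Rightarrow> real \<Rightarrow> bool" where
  "returns w P k \<epsilon> xs cs h \<longleftrightarrow>
     (\<exists>s ys ds. exec w P (initial_registers w k \<epsilon>, xs, cs) (s, ys, ds) \<and> h = real (s 0) / real (s 1))"

text \<open>
  A word has \<open>\<Theta>(log (k/\<epsilon>))\<close> bits, with \<open>c\<close> the hidden constant factor.  The rounding matters only
  when \<open>k/\<epsilon>\<close> is close to 1, where it makes a word nonempty.
\<close>

definition word_length :: "nat \<Rightarrow> nat \<Rightarrow> real \<Rightarrow> nat" where
  "word_length c k \<epsilon> = c * nat \<lceil>log 2 (real k / \<epsilon>)\<rceil>"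

text \<open>
  The rate \<open>k log\<^sup>4 (1/\<epsilon>) / \<epsilon>\<^sup>2\<close>.  For \<open>\<epsilon> \<le> 1/2\<close> the maximum is just \<open>log 2 (1/\<epsilon>)\<close>.  As \<open>\<epsilon>\<close>
  tends to 1 the logarithm vanishes, so that no constant multiple of the unmodified rate
  would allow even one sample.
\<close>

definition sample_rate :: "nat \<Rightarrow> real \<Rightarrow> real" where
  "sample_rate k \<epsilon> = real k * (max 1 (log 2 (1 / \<epsilon>))) ^ 4 / \<epsilon>\<^sup>2"

text \<open>\<open>n\<close> i.i.d. samples from \<open>D\<close> together with \<open>b\<close> independent fair coin flips.\<close>

definition samples_and_coins :: "nat \<Rightarrow> nat \<Rightarrow> nat pmf \<Rightarrow> (nat list \<times> bool list) pmf" where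
  "samples_and_coins n b D = pair_pmf (replicate_pmf n D) (replicate_pmf b (bernoulli_pmf (1 / 2)))"

end

theory Submission
  imports Defs
begin

text \<open>
  Summation of \<open>- ln p = (\<Sum>j\<ge>1. (1 - p) ^ j / j)\<close> shows that the entropy in nats is
  \<open>\<Sum>j\<ge>1. q j / j\<close>, where \<open>q j\<close> is the probability that a sample does not occur among the next
  \<open>j\<close> samples.  As \<open>p * (1 - p) ^ j \<le> 1 / (j + 1)\<close>, we have \<open>q j \<le> k / j\<close>, and truncation at \<open>M\<close>
  costs at most \<open>k / M\<close>.  The part of the series with \<open>4 ^ l \<le> j < 4 ^ (l + 1)\<close> has an unbiased
  estimator of bounded size that reads a fixed block of \<open>4 ^ (l + 1)\<close> samples.  Averaging it over a
  number of blocks that decreases geometrically with \<open>l\<close> balances variance against samples, and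
  Chebyshev's inequality applies to the sum of the independent blocks.  The program evaluates the
  coefficients \<open>1 / j\<close> in fixed point arithmetic with scale \<open>S = M\<^sup>2\<close>, and it converts to bits by
  the approximation of \<open>ln 2\<close> by \<open>\<Sum>j = M..<2 * M. 1 / j\<close>.
\<close>

section \<open>Weakest preconditions\<close>

text \<open>Total correctness: the existential includes termination and a sufficient supply of
  samples. As \<open>exec\<close> is deterministic, some outcome is the only outcome.\<close>

definition wp :: "nat \<Rightarrow> com \<Rightarrow> (config \<Rightarrow> bool) \<Rightarrow> config \<Rightarrow> bool" where
  "wp w P Q c \<longleftrightarrow> (\<exists>c'. exec w P c c' \<and> Q c')"

inductive_cases execE:
  "exec w Skip c c'" "exec w (Assign r a) c c'" "exec w (Next r) c c'" "exec w (Seq P Q) c c'"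
  "exec w (Cond a P Q) c c'"

lemma exec_iffs:
  "exec w Skip c c' \<longleftrightarrow> c' = c"
  "exec w (Assign r a) (s, xs, cs) c' \<longleftrightarrow> c' = (s(r := aval w s a), xs, cs)"
  "exec w (Next r) (s, x # xs, cs) c' \<longleftrightarrow> c' = (s(r := word w x), xs, cs)"
  "exec w (Seq P P') c c'' \<longleftrightarrow> (\<exists>c'. exec w P c c' \<and> exec w P' c' c'')"
  "exec w (Cond a P P') c c' \<longleftrightarrow> (if aval w (fst c) a \<noteq> 0 then exec w P c c' else exec w P' c c')"
  by (blast elim: execE intro: exec.intros, blast elim: execE intro: exec.intros,
      blast elim: execE intro: exec.intros, blast elim: execE intro: exec.intros,
      auto elim: execE intro: exec.CondTrue exec.CondFalse)

lemma wp_simps [simp]: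
  "wp w Skip Q c \<longleftrightarrow> Q c"
  "wp w (Assign r a) Q (s, xs, cs) \<longleftrightarrow> Q (s(r := aval w s a), xs, cs)"
  "wp w (Next r) Q (s, x # xs, cs) \<longleftrightarrow> Q (s(r := word w x), xs, cs)"
  "wp w (Seq P P') Q c \<longleftrightarrow> wp w P (wp w P' Q) c"
  "wp w (Cond a P P') Q c \<longleftrightarrow> (if aval w (fst c) a \<noteq> 0 then wp w P Q c else wp w P' Q c)"
  unfolding wp_def exec_iffs by (blast, blast, blast, blast, presburger)

text \<open>The number of iterations of each loop is determined by the inputs. The invariant
  therefore carries an iteration index, and termination follows by descending induction from the
  last index \<open>m\<close>.\<close>

lemma wp_While:
  assumes "I i c" "i \<le> m"
    and step: "\<And>i c. i < m \<Longrightarrow> I i c \<Longrightarrow> aval w (fst c) a \<noteq> 0 \<and> wp w P (I (Suc i)) c"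
    and final: "\<And>c. I m c \<Longrightarrow> aval w (fst c) a = 0 \<and> Q c"
  shows "wp w (While a P) Q c"
  using \<open>i \<le> m\<close> \<open>I i c\<close>
proof (induction arbitrary: c rule: inc_induct)
  case base
  then show ?case using final unfolding wp_def by (blast intro: exec.WhileFalse)
next
  case (step n)
  then show ?case using assms(3) unfolding wp_def by (meson exec.WhileTrue)
qed

section \<open>The program\<close>

text \<open>In terms of the locale \<open>parameters\<close>, \<open>rT\<close>, \<open>rP\<close>,
  \<open>rD\<close> end up holding 4^K, 2^K, 4^d, while \<open>rF\<close>, \<open>rM\<close>,
  \<open>rS\<close>, \<open>rZ\<close>, \<open>rL\<close> hold the constants of the same letter and
  \<open>rR\<close>, \<open>rW\<close> the values of \<open>R\<close>, \<open>W\<close> at the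
  current level l. \<open>rX\<close> is 4^l, \<open>rA\<close> the accumulator, \<open>rI\<close>
  the first sample of a block, \<open>rY\<close> the current one, and \<open>rV\<close> tells that
  the first one has not recurred.\<close>

abbreviation (input) "rK \<equiv> 0::nat"
abbreviation (input) "rN \<equiv> 1::nat"
abbreviation (input) "rT \<equiv> 2::nat"
abbreviation (input) "rP \<equiv> 3::nat"
abbreviation (input) "rQ \<equiv> 4::nat"
abbreviation (input) "rD \<equiv> 5::nat"
abbreviation (input) "rF \<equiv> 6::nat"
abbreviation (input) "rM \<equiv> 7::nat"
abbreviation (input) "rS \<equiv> 8::nat"
abbreviation (input) "rZ \<equiv> 9::nat"
abbreviation (input) "rR \<equiv> 10::nat"
abbreviation (input) "rW \<equiv> 11::nat"
abbreviation (input) "rX \<equiv> 12::nat"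
abbreviation (input) "rA \<equiv> 13::nat"
abbreviation (input) "rC \<equiv> 14::nat"
abbreviation (input) "rI \<equiv> 15::nat"
abbreviation (input) "rJ \<equiv> 16::nat"
abbreviation (input) "rV \<equiv> 17::nat"
abbreviation (input) "rY \<equiv> 18::nat"
abbreviation (input) "rL \<equiv> 19::nat"

fun seq :: "com list \<Rightarrow> com" where
  "seq [] = Skip"
| "seq (P # Ps) = Seq P (seq Ps)"

definition scale_loop :: com where
  "scale_loop = seq [Assign rT (Const 1), Assign rP (Const 1),
     While (Less (Reg rT) (Reg rK)) (seq [
       Assign rT (Times (Const 4) (Reg rT)), Assign rP (Times (Const 2) (Reg rP))])]"

text \<open>The initial values are 4^2 and 27 * 3, so that after \<open>e\<close> rounds the
  registers hold 4^d and 27 * (d + 1) with d = e + 2.\<close>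

definition accuracy_loop :: com where
  "accuracy_loop = seq [Assign rQ (Const 1), Assign rD (Const 16), Assign rF (Const 81),
     While (Less (Reg rQ) (Reg rN)) (seq [
       Assign rQ (Times (Const 2) (Reg rQ)), Assign rD (Times (Const 4) (Reg rD)),
       Assign rF (Plus (Reg rF) (Const 27))])]"

definition parameter_assignments :: com where
  "parameter_assignments = seq [
     Assign rM (Times (Reg rT) (Reg rD)), Assign rS (Times (Reg rM) (Reg rM)),
     Assign rZ (Times (Times (Reg rF) (Reg rD)) (Reg rP)), Assign rR (Reg rZ),
     Assign rW (Const 1), Assign rX (Const 1), Assign rA (Const 0)]"

text \<open>The block is read to its end even after the first sample has recurred, which keeps its
  length fixed. Two samples differ iff the sum of the two strict comparisons is nonzero.\<close>

definition sample_loop :: com where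
  "sample_loop = seq [Next rI, Assign rJ (Const 1), Assign rV (Const 1),
     While (Less (Reg rJ) (Times (Const 4) (Reg rX))) (seq [Next rY,
       Cond (Plus (Less (Reg rI) (Reg rY)) (Less (Reg rY) (Reg rI))) Skip (Assign rV (Const 0)),
       Cond (Reg rV)
         (Cond (Less (Reg rJ) (Reg rX)) Skip
           (Assign rA (Plus (Reg rA) (Times (Reg rW) (Quot (Reg rS) (Reg rJ))))))
         Skip,
       Assign rJ (Plus (Reg rJ) (Const 1))])]"

definition repetition_loop :: com where
  "repetition_loop = seq [Assign rC (Reg rR),
     While (Reg rC) (seq [sample_loop, Assign rC (Minus (Reg rC) (Const 1))])]"

definition level_loop :: com where
  "level_loop = While (Less (Reg rX) (Reg rM)) (seq [repetition_loop,
     Cond (Less (Reg rX) (Reg rT))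
       (seq [Assign rW (Times (Const 2) (Reg rW)), Assign rR (Quot (Reg rR) (Const 2))])
       (seq [Assign rW (Times (Const 4) (Reg rW)), Assign rR (Quot (Reg rR) (Const 4))]),
     Assign rX (Times (Const 4) (Reg rX))])"

definition logarithm_loop :: com where
  "logarithm_loop = seq [Assign rL (Const 0), Assign rJ (Reg rM),
     While (Less (Reg rJ) (Times (Const 2) (Reg rM))) (seq [
       Assign rL (Plus (Reg rL) (Quot (Reg rS) (Reg rJ))),
       Assign rJ (Plus (Reg rJ) (Const 1))])]"

definition entropy_program :: com where
  "entropy_program = seq [scale_loop, accuracy_loop, parameter_assignments, level_loop,
     logarithm_loop, Assign 0 (Reg rA), Assign 1 (Times (Reg rL) (Reg rZ))]"

section \<open>Functional correctness\<close>

text \<open>One first sample serves all indices \<open>j\<close>: the indicators are dependent, but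
  each has expectation \<open>q j\<close>, and linearity makes the sum an unbiased estimator of its
  piece of the series.\<close>

definition block_value :: "(nat \<Rightarrow> nat) \<Rightarrow> nat \<Rightarrow> nat list \<Rightarrow> nat" where
  "block_value a x zs = (\<Sum>j = x..<4 * x. a j * of_bool (hd zs \<notin> set (take j (tl zs))))"

fun total_value :: "(nat \<Rightarrow> nat) \<Rightarrow> (nat \<times> nat) list \<Rightarrow> nat list \<Rightarrow> nat" where
  "total_value a [] zs = 0"
| "total_value a ((W, x) # bs) zs = W * block_value a x zs + total_value a bs (drop (4 * x) zs)"

definition total_length :: "(nat \<times> nat) list \<Rightarrow> nat" where
  "total_length bs = (\<Sum>(W, x)\<leftarrow>bs. 4 * x)"

lemma word_id: "v < 2 ^ w \<Longrightarrow> word w v = v"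
  by (simp add: word_def)

lemma block_value_le:
  assumes "x > 0"
  shows "block_value (\<lambda>j. S div j) x zs \<le> 3 * S"
proof -
  have "block_value (\<lambda>j. S div j) x zs \<le> (\<Sum>j = x..<4 * x. S div x)"
    unfolding block_value_def using assms by (intro sum_mono) (auto simp: div_le_mono2)
  also have "\<dots> = 3 * (x * (S div x))" by simp
  also have "\<dots> \<le> 3 * S" by (intro mult_left_mono) auto
  finally show ?thesis .
qed

lemma total_value_append:
  "total_value a (bs @ bs') zs = total_value a bs zs + total_value a bs' (drop (total_length bs) zs)"
  by (induction a bs zs rule: total_value.induct) (auto simp: total_length_def add.commute)

lemma total_length_append [simp]: "total_length (bs @ bs') = total_length bs + total_length bs'"
  by (simp add: total_length_def)

lemma total_length_replicate [simp]: "total_length (replicate r (W, x)) = r * (4 * x)"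
  by (induction r) (auto simp: total_length_def)

text \<open>The paired conditions make \<open>K\<close> and \<open>e\<close> minimal, which is the
  exit condition of \<open>scale_loop\<close> and \<open>accuracy_loop\<close>. The last assumption
  is 64 * Z * M^4 < 2^w with the later definitions of \<open>Z\<close> and \<open>M\<close> written
  out.\<close>

locale parameters =
  fixes k N K e w :: nat
  assumes K: "k \<le> 4 ^ K" "\<And>i. i < K \<Longrightarrow> 4 ^ i < k"
    and e: "N \<le> 2 ^ e" "\<And>i. i < e \<Longrightarrow> 2 ^ i < N"
    and word_bound: "64 * (27 * (e + 3) * 4 ^ (e + 2) * 2 ^ K) * (4 ^ (K + (e + 2))) ^ 4 < (2::nat) ^ w"
begin

text \<open>
  The value of a block of level \<open>l\<close> is at most \<open>3 * S\<close>, and for \<open>l \<ge> K\<close> it is nonzero only with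
  probability at most \<open>k / 4 ^ l\<close>, hence at most \<open>4 ^ K / 4 ^ l\<close>.  The number \<open>R l\<close> of repetitions decays like \<open>2 ^ - l\<close> up to level \<open>K\<close> and like
  \<open>4 ^ - l\<close> afterwards, so that both the variance and the number of samples are geometric sums over
  the levels below \<open>K\<close>, and only the \<open>d\<close> levels from \<open>K\<close> on cost a factor logarithmic in \<open>1/\<epsilon>\<close>.
\<close>

definition "d = e + 2"
definition M :: nat where "M = 4 ^ (K + d)"
definition S :: nat where "S = M * M"
definition F :: nat where "F = 27 * (d + 1)"
definition Z :: nat where "Z = F * 4 ^ d * 2 ^ K"
definition W :: "nat \<Rightarrow> nat" where "W l = 2 ^ min l K * 4 ^ (l - K)"
definition R :: "nat \<Rightarrow> nat" where "R l = F * 4 ^ (d - (l - K)) * 2 ^ (K - l)"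
definition level :: "nat \<Rightarrow> (nat \<times> nat) list" where "level l = replicate (R l) (W l, 4 ^ l)"
definition levels :: "nat \<Rightarrow> (nat \<times> nat) list" where "levels l = concat (map level [l..<K + d])"

text \<open>Repetitions times weight is the same on all levels, so every piece of the series enters
  the total with the common factor \<open>Z\<close>, which is divided out at the end.\<close>

lemma R_W: "l \<le> K + d \<Longrightarrow> R l * W l = Z"
proof -
  assume l: "l \<le> K + d"
  have "R l * W l = F * 4 ^ (d - (l - K) + (l - K)) * 2 ^ (K - l + min l K)"
    by (simp add: R_def W_def power_add)
  also have "d - (l - K) + (l - K) = d" using l by simp
  also have "K - l + min l K = K" by simp
  finally show ?thesis by (simp add: Z_def)
qed

lemma R_pos: "R l > 0" and Z_pos: "Z > 0" and M_pos: "M > 0"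
  by (simp_all add: R_def Z_def F_def M_def)

lemma R_0: "R 0 = Z" and W_0: "W 0 = 1"
  by (simp_all add: R_def Z_def W_def)

text \<open>These are the updates made by \<open>level_loop\<close>. The divisions are exact,
  because the exponent that decreases is still positive.\<close>

lemma R_Suc: "l < K + d \<Longrightarrow> R (Suc l) = R l div (if l < K then 2 else 4)"
  and W_Suc: "W (Suc l) = (if l < K then 2 else 4) * W l"
proof -
  assume "l < K + d"
  show "R (Suc l) = R l div (if l < K then 2 else 4)"
  proof (cases "l < K")
    case True
    then have "K - l = Suc (K - Suc l)" by simp
    then show ?thesis using True by (simp add: R_def)
  next
    case False
    then have "d - (l - K) = Suc (d - (Suc l - K))" using \<open>l < K + d\<close> by simp
    then have "R l = 4 * R (Suc l)" using False by (simp add: R_def)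
    then show ?thesis using False by simp
  qed
next
  show "W (Suc l) = (if l < K then 2 else 4) * W l"
    by (auto simp: W_def Suc_diff_le min_def)
qed

lemma word_bound': "64 * Z * M ^ 4 < 2 ^ w"
  using word_bound by (simp only: Z_def M_def F_def d_def add.assoc mult.assoc one_add_one add_2_eq_Suc') (simp add: numeral_3_eq_3)

lemma less_word: "v \<le> 64 * Z * M ^ 4 \<Longrightarrow> v < 2 ^ w"
  using word_bound' by simp

lemma total_value_replicate_le:
  "x > 0 \<Longrightarrow> total_value (\<lambda>j. S div j) (replicate r (V, x)) zs \<le> r * V * (3 * S)"
proof (induction r arbitrary: zs)
  case (Suc r)
  have "V * block_value (\<lambda>j. S div j) x zs \<le> V * (3 * S)"
    using block_value_le[OF Suc.prems] by simp
  with Suc.IH[OF Suc.prems, of "drop (4 * x) zs"] show ?case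
    unfolding replicate_Suc total_value.simps mult_Suc add_mult_distrib by (metis add_mono)
qed simp

lemma levels_Cons: "l < K + d \<Longrightarrow> levels l = level l @ levels (Suc l)"
  by (simp add: levels_def upt_conv_Cons)

text \<open>A level contributes at most R l * W l * 3 S = 3 Z S for arbitrary samples, so overflow
  is excluded with certainty and not just with high probability.\<close>

lemma total_value_levels_le:
  "l \<le> K + d \<Longrightarrow> total_value (\<lambda>j. S div j) (levels l) zs \<le> (K + d - l) * (Z * (3 * S))"
proof (induction arbitrary: zs rule: inc_induct)
  case base
  then show ?case by (simp add: levels_def)
next
  case (step n)
  have "levels n = level n @ levels (Suc n)"
    using step by (simp add: levels_Cons)
  moreover have "total_value (\<lambda>j. S div j) (level n) zs \<le> Z * (3 * S)"
    using total_value_replicate_le[of "4 ^ n" "R n" "W n"] R_W[of n] step by (simp add: level_def)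
  moreover have "K + d - n = Suc (K + d - Suc n)" using step by simp
  ultimately show ?case using step.IH[of "drop (total_length (level n)) zs"]
    by (simp add: total_value_append)
qed

lemma KdM: "K + d < M"
  unfolding M_def using less_exp[of "K + d"] by (rule less_le_trans) (simp add: power_mono)

lemma total_value_bound: "total_value (\<lambda>j. S div j) (levels 0) zs \<le> 3 * Z * M ^ 3"
proof -
  have "total_value (\<lambda>j. S div j) (levels 0) zs \<le> (K + d) * (Z * (3 * S))"
    using total_value_levels_le[of 0] by simp
  also have "\<dots> \<le> M * (Z * (3 * S))" using KdM by (intro mult_right_mono) auto
  finally show ?thesis by (simp add: S_def algebra_simps power3_eq_cube)
qed

end

section \<open>Correctness of a single block and of its repetition\<close>

lemma wp_sample_loop:
  assumes x: "s rX = x" "x > 0" "4 * x < 2 ^ w"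
    and zs: "4 * x \<le> length zs" "set zs \<subseteq> {..<2 ^ w}"
    and bound: "s rA + s rW * block_value (\<lambda>j. s rS div j) x zs < 2 ^ w"
    and s: "s rS < 2 ^ w" "s rW < 2 ^ w"
    and Q: "\<And>s'. s' rA = s rA + s rW * block_value (\<lambda>j. s rS div j) x zs \<Longrightarrow>
      (\<And>r. r \<notin> {rA, rI, rJ, rV, rY} \<Longrightarrow> s' r = s r) \<Longrightarrow> Q (s', drop (4 * x) zs, cs)"
  shows "wp w sample_loop Q (s, zs, cs)"
proof -
  obtain i ys where zs_eq: "zs = i # ys"
    using zs x by (cases zs) auto
  define a where "a = (\<lambda>j. s rS div j * of_bool (i \<notin> set (take j ys)))"
  have block: "block_value (\<lambda>j. s rS div j) x zs = (\<Sum>j = x..<4 * x. a j)"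
    by (simp add: block_value_def a_def zs_eq)
  \<comment> \<open>At index \<open>j\<close> the first sample and \<open>j - 1\<close> further ones
    have been read. The term for \<open>j\<close> is added only after the next sample has been
    compared.\<close>
  define I where "I = (\<lambda>j (s', ys', cs'). cs' = cs \<and> ys' = drop (j - 1) ys \<and> s' rI = i \<and> s' rJ = j \<and>
    s' rV = of_bool (i \<notin> set (take (j - 1) ys)) \<and> s' rA = s rA + s rW * (\<Sum>j = x..<j. a j) \<and>
    j \<ge> 1 \<and> (\<forall>r. r \<notin> {rA, rI, rJ, rV, rY} \<longrightarrow> s' r = s r))"
  have pow: "2 < (2::nat) ^ w" "Suc 0 < 2 ^ w" "1 < (2::nat) ^ w" using x by linarith+
  have four: "4 < (2::nat) ^ w"
  proof (cases "x = 1")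
    case True
    then have "w > 2"
      using x(3) power_increasing[of w 2 "2::nat"] by (cases "w \<le> 2") auto
    then show ?thesis using power_strict_increasing[of 2 w "2::nat"] by simp
  qed (use x in linarith)
  note word = word_id
  show ?thesis
    unfolding sample_loop_def seq.simps wp_simps zs_eq
  proof (rule wp_While[where I = I and i = 1 and m = "4 * x"])
    show "I 1 (s(rI := word w i, rJ := aval w (s(rI := word w i)) (Const 1),
      rV := aval w (s(rI := word w i, rJ := aval w (s(rI := word w i)) (Const 1))) (Const 1)), ys, cs)"
      using zs pow x by (auto simp: I_def zs_eq word)
  next
    show "1 \<le> 4 * x" using x by simp
  next
    fix j c assume j: "j < 4 * x" and I: "I j c"
    obtain s' where c: "c = (s', drop (j - 1) ys, cs)" and s': "s' rI = i" "s' rJ = j"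
      "s' rV = of_bool (i \<notin> set (take (j - 1) ys))" "s' rA = s rA + s rW * (\<Sum>j = x..<j. a j)" "j \<ge> 1"
      "\<And>r. r \<notin> {rA, rI, rJ, rV, rY} \<Longrightarrow> s' r = s r"
      using I by (cases c) (auto simp: I_def)
    have len: "j - 1 < length ys" using j zs s' by (simp add: zs_eq)
    define y where "y = ys ! (j - 1)"
    have drop: "drop (j - 1) ys = y # drop j ys"
      using Cons_nth_drop_Suc[OF len] s' by (simp add: y_def)
    have take: "take j ys = take (j - 1) ys @ [y]"
      using take_Suc_conv_app_nth[OF len] s' by (simp add: y_def)
    have y: "y < 2 ^ w" using zs nth_mem[OF len] by (auto simp: y_def zs_eq)
    \<comment> \<open>All terms are natural numbers, so a bound on the final accumulator excludes
      overflow at every intermediate addition.\<close>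
    have sum_le: "(\<Sum>j = x..<Suc j. a j) \<le> (\<Sum>j = x..<4 * x. a j)"
      using j by (intro sum_mono2) auto
    have acc: "s rA + s rW * (\<Sum>j = x..<Suc j. a j) < 2 ^ w"
      using bound mult_left_mono[OF sum_le, of "s rW"] unfolding block by linarith
    have guard: "aval w s' (Less (Reg rJ) (Times (Const 4) (Reg rX))) = 1"
      using x(1,3) j s' by (simp add: word word[OF four] word[OF pow(2)])
    have S_j: "s rS div j < 2 ^ w" using s(1) div_le_dividend[of "s rS" j] by linarith
    show "aval w (fst c) (Less (Reg rJ) (Times (Const 4) (Reg rX))) \<noteq> 0 \<and>
      wp w (Seq (Next rY) (Seq (Cond (Plus (Less (Reg rI) (Reg rY)) (Less (Reg rY) (Reg rI))) Skip
         (Assign rV (Const 0))) (Seq (Cond (Reg rV) (Cond (Less (Reg rJ) (Reg rX)) Skip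
           (Assign rA (Plus (Reg rA) (Times (Reg rW) (Quot (Reg rS) (Reg rJ)))))) Skip)
           (Seq (Assign rJ (Plus (Reg rJ) (Const 1))) Skip)))) (I (Suc j)) c"
    proof (intro conjI)
      show "aval w (fst c) (Less (Reg rJ) (Times (Const 4) (Reg rX))) \<noteq> 0"
        using guard by (simp add: c)
      have neq: "aval w (s'(rY := y)) (Plus (Less (Reg rI) (Reg rY)) (Less (Reg rY) (Reg rI))) = of_bool (i \<noteq> y)"
        using pow s' by (auto simp: word)
      have lt: "aval w s'' (Less (Reg rJ) (Reg rX)) = of_bool (j < x)" if "s'' rJ = j" "s'' rX = x" for s''
        using pow that by (auto simp: word)
      have inc: "aval w s'' (Plus (Reg rJ) (Const 1)) = Suc j" if "s'' rJ = j" for s''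
        using pow j x that by (auto simp: word)
      have upd: "aval w s'' (Plus (Reg rA) (Times (Reg rW) (Quot (Reg rS) (Reg rJ)))) =
          s rA + s rW * (\<Sum>j = x..<Suc j. a j)"
        if "s'' rJ = j" "s'' rA = s' rA" "s'' rW = s rW" "s'' rS = s rS" "i \<notin> set (take j ys)" "x \<le> j" for s''
      proof -
        have *: "s rA + s rW * (\<Sum>j = x..<Suc j. a j) =
            s' rA + s rW * (s rS div j)"
          using that by (simp add: s' a_def algebra_simps)
        then have "s rW * (s rS div j) < 2 ^ w" "s' rA + s rW * (s rS div j) < 2 ^ w"
          using acc by linarith+
        then show ?thesis using that S_j * by (simp add: word)
      qed
      show "wp w (Seq (Next rY) (Seq (Cond (Plus (Less (Reg rI) (Reg rY)) (Less (Reg rY) (Reg rI))) Skip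
         (Assign rV (Const 0))) (Seq (Cond (Reg rV) (Cond (Less (Reg rJ) (Reg rX)) Skip
           (Assign rA (Plus (Reg rA) (Times (Reg rW) (Quot (Reg rS) (Reg rJ)))))) Skip)
           (Seq (Assign rJ (Plus (Reg rJ) (Const 1))) Skip)))) (I (Suc j)) c"
      proof -
        have Reg: "aval w s'' (Reg r) = s'' r" and Zero: "aval w s'' (Const 0) = 0" for s'' r
          using pow by (simp_all add: word)
        have same: "sum a {x..<Suc j} = sum a {x..<j}" if "i \<in> set (take j ys) \<or> j < x"
          using that by (auto simp: a_def)
        have I_Suc: "I (Suc j) (s'', drop j ys, cs)"
          if "s'' rI = i" "s'' rJ = Suc j" "s'' rV = of_bool (i \<notin> set (take j ys))"
            "s'' rA = s rA + s rW * sum a {x..<Suc j}"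
            "\<And>r. r \<notin> {rA, rI, rJ, rV, rY} \<Longrightarrow> s'' r = s' r" for s''
          using that s'(6) unfolding I_def by simp
        \<comment> \<open>The new sample clears the flag; the flag was cleared before; the flag
          stands but \<open>j\<close> is below the range of the block; the term for \<open>j\<close>
          is added.\<close>
        consider "i = y" | "i \<noteq> y" "i \<in> set (take j ys)" | "i \<noteq> y" "i \<notin> set (take j ys)" "j < x"
          | "i \<noteq> y" "i \<notin> set (take j ys)" "x \<le> j" by linarith
        then show ?thesis
        proof cases
          case 1
          then show ?thesis
            unfolding c drop wp_simps word[OF y] fst_conv neq
            by (simp add: Reg Zero inc s' del: aval.simps)
              (rule I_Suc; simp add: s' take same inc[unfolded One_nat_def] Zero del: aval.simps sum.op_ivl_Suc)
        next
          case 2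
          then show ?thesis
            unfolding c drop wp_simps word[OF y] fst_conv neq
            by (simp add: Reg Zero inc s' take del: aval.simps)
              (rule I_Suc; simp add: s' take same inc[unfolded One_nat_def] Zero del: aval.simps sum.op_ivl_Suc)
        next
          case 3
          then show ?thesis
            unfolding c drop wp_simps word[OF y] fst_conv neq
            by (simp add: Reg Zero inc lt s' x take del: aval.simps)
              (rule I_Suc; simp add: s' take same inc[unfolded One_nat_def] Zero del: aval.simps sum.op_ivl_Suc)
        next
          case 4
          have lt': "aval w (s'(rY := y)) (Less (Reg rJ) (Reg rX)) = 0"
            using 4 s' x by (subst lt) auto
          have upd': "aval w (s'(rY := y)) (Plus (Reg rA) (Times (Reg rW) (Quot (Reg rS) (Reg rJ)))) =
              s rA + s rW * sum a {x..<Suc j}"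
            using 4 s' by (intro upd) auto
          show ?thesis
            unfolding c drop wp_simps word[OF y] fst_conv neq
            using 4 by (simp add: Reg Zero inc lt' upd' s' x take del: aval.simps sum.op_ivl_Suc)
              (rule I_Suc; simp add: s' take inc[unfolded One_nat_def] upd' del: aval.simps sum.op_ivl_Suc)
        qed
      qed
    qed
  next
    fix c assume I: "I (4 * x) c"
    obtain s' where c: "c = (s', drop (4 * x - 1) ys, cs)" and s': "s' rJ = 4 * x"
      "s' rA = s rA + s rW * (\<Sum>j = x..<4 * x. a j)"
      "\<And>r. r \<notin> {rA, rI, rJ, rV, rY} \<Longrightarrow> s' r = s r"
      using I by (cases c) (auto simp: I_def)
    have "drop (4 * x) zs = drop (4 * x - 1) ys"
      using x by (simp add: zs_eq drop_Cons')
    then show "aval w (fst c) (Less (Reg rJ) (Times (Const 4) (Reg rX))) = 0 \<and> Q c"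
      using x s' Q[of s'] by (auto simp: c word block)
  qed
qed

lemma wp_repetition_loop:
  assumes x: "s rX = x" "x > 0" "4 * x < 2 ^ w"
    and zs: "s rR * (4 * x) \<le> length zs" "set zs \<subseteq> {..<2 ^ w}"
    and bound: "s rA + total_value (\<lambda>j. s rS div j) (replicate (s rR) (s rW, x)) zs < 2 ^ w"
    and s: "s rS < 2 ^ w" "s rW < 2 ^ w" "s rR < 2 ^ w"
    and Q: "\<And>s'. s' rA = s rA + total_value (\<lambda>j. s rS div j) (replicate (s rR) (s rW, x)) zs \<Longrightarrow>
      (\<And>r. r \<notin> {rA, rC, rI, rJ, rV, rY} \<Longrightarrow> s' r = s r) \<Longrightarrow> Q (s', drop (s rR * (4 * x)) zs, cs)"
  shows "wp w repetition_loop Q (s, zs, cs)"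
proof -
  let ?total = "\<lambda>n. total_value (\<lambda>j. s rS div j) (replicate n (s rW, x))"
  \<comment> \<open>The accumulator plus the value of the blocks still to come is constant, so the
    bound on the total covers all intermediate states.\<close>
  define I where "I = (\<lambda>n (s', zs', cs'). cs' = cs \<and> zs' = drop (n * (4 * x)) zs \<and> s' rC = s rR - n \<and>
    s' rA + ?total (s rR - n) zs' = s rA + ?total (s rR) zs \<and>
    (\<forall>r. r \<notin> {rA, rC, rI, rJ, rV, rY} \<longrightarrow> s' r = s r))"
  show ?thesis
    unfolding repetition_loop_def seq.simps wp_simps
  proof (rule wp_While[where I = I and i = 0 and m = "s rR"])
    show "I 0 (s(rC := aval w s (Reg rR)), zs, cs)"
      by (simp add: I_def)
  next
    fix n c assume n: "n < s rR" and I: "I n c"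
    obtain s' where c: "c = (s', drop (n * (4 * x)) zs, cs)" and s': "s' rC = s rR - n"
      "s' rA + ?total (s rR - n) (drop (n * (4 * x)) zs) = s rA + ?total (s rR) zs"
      "\<And>r. r \<notin> {rA, rC, rI, rJ, rV, rY} \<Longrightarrow> s' r = s r"
      using I by (cases c) (auto simp: I_def)
    have Suc: "s rR - n = Suc (s rR - Suc n)" using n by simp
    have step: "s' rA + s rW * block_value (\<lambda>j. s rS div j) x (drop (n * (4 * x)) zs) +
        ?total (s rR - Suc n) (drop (Suc n * (4 * x)) zs) = s rA + ?total (s rR) zs"
      using s'(2) by (simp add: Suc add.commute)
    have "wp w sample_loop (wp w (Seq (Assign rC (Minus (Reg rC) (Const 1))) Skip) (I (Suc n))) c"
      unfolding c
    proof (rule wp_sample_loop[where x = x])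
      have "Suc n * (4 * x) \<le> s rR * (4 * x)" using n by (intro mult_right_mono) auto
      then show "4 * x \<le> length (drop (n * (4 * x)) zs)" using zs by simp
      show "set (drop (n * (4 * x)) zs) \<subseteq> {..<2 ^ w}"
        by (rule order_trans[OF set_drop_subset zs(2)])
      show "s' rA + s' rW * block_value (\<lambda>j. s' rS div j) x (drop (n * (4 * x)) zs) < 2 ^ w"
        using step bound by (simp add: s')
    next
      fix s'' :: "nat \<Rightarrow> nat"
      assume A: "s'' rA = s' rA + s' rW * block_value (\<lambda>j. s' rS div j) x (drop (n * (4 * x)) zs)"
        and frame: "\<And>r. r \<notin> {rA, rI, rJ, rV, rY} \<Longrightarrow> s'' r = s' r"
      have "s rR - n - Suc 0 < 2 ^ w" using s(3) by linarith
      moreover have "Suc 0 < 2 ^ w" using x by linarith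
      ultimately have "aval w s'' (Minus (Reg rC) (Const 1)) = s rR - Suc n"
        by (simp add: frame s' word_id)
      then show "wp w (Seq (Assign rC (Minus (Reg rC) (Const 1))) Skip) (I (Suc n))
          (s'', drop (4 * x) (drop (n * (4 * x)) zs), cs)"
        using step A by (simp add: I_def frame s' add.commute)
    qed (use s x in \<open>auto simp: s'\<close>)
    then show "aval w (fst c) (Reg rC) \<noteq> 0 \<and>
        wp w (Seq sample_loop (Seq (Assign rC (Minus (Reg rC) (Const 1))) Skip)) (I (Suc n)) c"
      using n by (simp add: c s')
  next
    fix c assume "I (s rR) c"
    then show "aval w (fst c) (Reg rC) = 0 \<and> Q c"
      using Q by (cases c) (auto simp: I_def)
  qed simp
qed

section \<open>Absence of overflow and correctness of the outer loops\<close>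

context parameters
begin

lemma R_le: "R l \<le> Z"
proof -
  have "(4::nat) ^ (d - (l - K)) \<le> 4 ^ d" "(2::nat) ^ (K - l) \<le> 2 ^ K"
    by (intro power_increasing; simp)+
  then show ?thesis unfolding R_def Z_def by (intro mult_mono) auto
qed

lemma W_le: "l \<le> K + d \<Longrightarrow> W l \<le> Z"
  using R_W[of l] R_pos[of l] by (metis Suc_leI mult_le_mono1 nat_mult_1 One_nat_def)

lemma M_power_le: "i \<le> 4 \<Longrightarrow> v \<le> 64 \<Longrightarrow> v * M ^ i < 2 ^ w"
proof -
  assume "i \<le> 4" "v \<le> 64"
  have "v * M ^ i \<le> 64 * Z * M ^ 4"
    using \<open>i \<le> 4\<close> \<open>v \<le> 64\<close> Z_pos M_pos by (intro mult_mono power_increasing) (auto intro: le_trans[of _ "64 * 1"])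
  then show ?thesis by (rule less_word)
qed

lemma Z_M_power_le: "i \<le> 4 \<Longrightarrow> v \<le> 64 \<Longrightarrow> v * Z * M ^ i < 2 ^ w"
  using M_pos by (intro less_word mult_mono power_increasing) auto

lemma wp_level_loop:
  assumes s: "s rX = 1" "s rW = 1" "s rR = Z" "s rA = 0" "s rS = S" "s rM = M" "s rT = 4 ^ K" "s rZ = Z"
    and zs: "total_length (levels 0) \<le> length zs" "set zs \<subseteq> {..<2 ^ w}"
    and Q: "\<And>s' ys. s' rA = total_value (\<lambda>j. S div j) (levels 0) zs \<Longrightarrow> s' rS = S \<Longrightarrow> s' rM = M \<Longrightarrow>
      s' rZ = Z \<Longrightarrow> Q (s', ys, cs)"
  shows "wp w level_loop Q (s, zs, cs)"
proof -
  let ?total = "\<lambda>l. total_value (\<lambda>j. S div j) (levels l)"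
  \<comment> \<open>Again accumulator plus remaining value is constant. At index
    \<open>K + d\<close> no level remains, which yields the final accumulator.\<close>
  define I where "I = (\<lambda>l (s, zs', cs'). cs' = cs \<and> total_length (levels l) \<le> length zs' \<and>
    set zs' \<subseteq> {..<2 ^ w} \<and> s rX = 4 ^ l \<and> s rW = W l \<and> s rR = R l \<and> s rS = S \<and> s rM = M \<and>
    s rT = 4 ^ K \<and> s rZ = Z \<and> s rA + ?total l zs' = ?total 0 zs)"
  have S: "S < 2 ^ w" using M_power_le[of 2 1] by (simp add: S_def power2_eq_square)
  have M: "4 * M < 2 ^ w" using M_power_le[of 1 4] by simp
  have Z: "4 * Z < 2 ^ w" using Z_M_power_le[of 0 4] by simp
  have bound: "?total 0 zs < 2 ^ w"
    using total_value_bound[of zs] Z_M_power_le[of 3 3] by simp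
  show ?thesis
    unfolding level_loop_def seq.simps wp_simps
  proof (rule wp_While[where I = I and i = 0 and m = "K + d"])
    show "I 0 (s, zs, cs)"
      using s zs by (simp add: I_def R_0 W_0)
  next
    fix l c assume l: "l < K + d" and I: "I l c"
    obtain s zs' where c: "c = (s, zs', cs)" and zs': "total_length (levels l) \<le> length zs'"
      "set zs' \<subseteq> {..<2 ^ w}" and s: "s rX = 4 ^ l" "s rW = W l" "s rR = R l" "s rS = S" "s rM = M"
      "s rT = 4 ^ K" "s rZ = Z" "s rA + ?total l zs' = ?total 0 zs"
      using I by (cases c) (auto simp: I_def)
    have xM: "4 ^ Suc l \<le> M" unfolding M_def using l by (intro power_increasing) auto
    then have xM': "4 ^ l < M" by (simp add: less_le_trans[rotated])
    from xM have x: "4 * 4 ^ l < (2::nat) ^ w" using M by simp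
    have sum: "s rA + total_value (\<lambda>j. S div j) (level l) zs' +
        ?total (Suc l) (drop (total_length (level l)) zs') = ?total 0 zs"
      using s(8) by (simp add: levels_Cons[OF l] total_value_append)
    have guard: "aval w s (Less (Reg rX) (Reg rM)) = 1"
      using xM xM' x M s M_power_le[of 0 4] M_power_le[of 0 1] by (simp add: word_id)
    have "wp w repetition_loop (wp w (Seq (Cond (Less (Reg rX) (Reg rT))
       (Seq (Assign rW (Times (Const 2) (Reg rW))) (Seq (Assign rR (Quot (Reg rR) (Const 2))) Skip))
       (Seq (Assign rW (Times (Const 4) (Reg rW))) (Seq (Assign rR (Quot (Reg rR) (Const 4))) Skip)))
       (Seq (Assign rX (Times (Const 4) (Reg rX))) Skip)) (I (Suc l))) c"
      unfolding c
    proof (rule wp_repetition_loop[where x = "4 ^ l"])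
      show "s rR * (4 * 4 ^ l) \<le> length zs'"
        using zs' by (simp add: levels_Cons[OF l] level_def s)
      show "s rA + total_value (\<lambda>j. s rS div j) (replicate (s rR) (s rW, 4 ^ l)) zs' < 2 ^ w"
        using sum bound by (simp add: level_def s)
      show "s rR < 2 ^ w" "s rW < 2 ^ w"
        using R_le[of l] W_le[of l] l Z s by linarith+
    next
      fix s' :: "nat \<Rightarrow> nat"
      assume A: "s' rA = s rA + total_value (\<lambda>j. s rS div j) (replicate (s rR) (s rW, 4 ^ l)) zs'"
        and frame: "\<And>r. r \<notin> {rA, rC, rI, rJ, rV, rY} \<Longrightarrow> s' r = s r"
      have drop: "drop (s rR * (4 * 4 ^ l)) zs' = drop (total_length (level l)) zs'"
        by (simp add: level_def s)
      have A': "s' rA + ?total (Suc l) (drop (total_length (level l)) zs') = ?total 0 zs"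
        using sum A by (simp add: level_def s)
      have len: "total_length (levels (Suc l)) \<le> length zs' - total_length (level l)"
        using zs' by (simp add: levels_Cons[OF l])
      have sub: "set (drop (total_length (level l)) zs') \<subseteq> {..<2 ^ w}"
        by (rule order_trans[OF set_drop_subset zs'(2)])
      have W4: "4 * W l < 2 ^ w" "2 * W l < 2 ^ w" "R l div 2 < 2 ^ w" "R l div 4 < 2 ^ w"
        "4 < (2::nat) ^ w" "2 < (2::nat) ^ w" "1 < (2::nat) ^ w" "Suc 0 < (2::nat) ^ w"
        using R_le[of l] W_le[of l] l Z Z_M_power_le[of 0 4] Z_pos by linarith+
      show "wp w (Seq (Cond (Less (Reg rX) (Reg rT))
       (Seq (Assign rW (Times (Const 2) (Reg rW))) (Seq (Assign rR (Quot (Reg rR) (Const 2))) Skip))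
       (Seq (Assign rW (Times (Const 4) (Reg rW))) (Seq (Assign rR (Quot (Reg rR) (Const 4))) Skip)))
       (Seq (Assign rX (Times (Const 4) (Reg rX))) Skip)) (I (Suc l))
       (s', drop (s rR * (4 * 4 ^ l)) zs', cs)"
      proof -
        have s': "s' rX = 4 ^ l" "s' rW = W l" "s' rR = R l" "s' rS = S" "s' rM = M"
          "s' rT = 4 ^ K" "s' rZ = Z"
          by (simp_all add: frame s)
        have words: "word w 1 = 1" "word w (Suc 0) = Suc 0" "word w 2 = 2" "word w 4 = 4"
          "word w (4 * 4 ^ l) = 4 * 4 ^ l" "word w (4 * W l) = 4 * W l" "word w (2 * W l) = 2 * W l"
          "word w (R l div 2) = R l div 2" "word w (R l div 4) = R l div 4"
          using W4 x by (simp_all only: word_id)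
        have lt: "(4::nat) ^ l < 4 ^ K \<longleftrightarrow> l < K" by simp
        show ?thesis
        proof (cases "l < K")
          case True
          then show ?thesis
            using A' len sub R_Suc[OF l] W_Suc[of l] unfolding drop I_def
            by (simp add: s' words word_id[of 0])
        next
          case False
          then have "word w 0 = 0" by (simp add: word_def)
          then show ?thesis
            using False A' len sub R_Suc[OF l] W_Suc[of l] unfolding drop I_def
            by (simp add: s' words)
        qed
      qed
    qed (use s x zs' S in auto)
    then show "aval w (fst c) (Less (Reg rX) (Reg rM)) \<noteq> 0 \<and> wp w (Seq repetition_loop (Seq
       (Cond (Less (Reg rX) (Reg rT))
       (Seq (Assign rW (Times (Const 2) (Reg rW))) (Seq (Assign rR (Quot (Reg rR) (Const 2))) Skip))
       (Seq (Assign rW (Times (Const 4) (Reg rW))) (Seq (Assign rR (Quot (Reg rR) (Const 4))) Skip)))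
       (Seq (Assign rX (Times (Const 4) (Reg rX))) Skip))) (I (Suc l)) c"
      using guard by (simp add: c)
  next
    fix c assume "I (K + d) c"
    then obtain s zs' where c: "c = (s, zs', cs)" and s: "s rX = M" "s rM = M" "s rS = S" "s rZ = Z"
      "s rA = ?total 0 zs"
      by (cases c) (auto simp: I_def M_def levels_def)
    then show "aval w (fst c) (Less (Reg rX) (Reg rM)) = 0 \<and> Q c"
      using Q by (simp add: word_def)
  qed simp
qed

text \<open>The fixed point value of ln 2 at scale \<open>S\<close>.\<close>

definition L :: nat where "L = (\<Sum>j = M..<2 * M. S div j)"

lemma L_le: "L \<le> S"
proof -
  have "L \<le> (\<Sum>j = M..<2 * M. S div M)"
    unfolding L_def using M_pos by (intro sum_mono) (auto simp: div_le_mono2)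
  then show ?thesis using M_pos by (simp add: S_def)
qed

lemma wp_logarithm_loop:
  assumes s: "s rS = S" "s rM = M"
    and Q: "\<And>s'. s' rL = L \<Longrightarrow> s' rA = s rA \<Longrightarrow> s' rZ = s rZ \<Longrightarrow> Q (s', zs, cs)"
  shows "wp w logarithm_loop Q (s, zs, cs)"
proof -
  define I where "I = (\<lambda>j (s', zs', cs'). cs' = cs \<and> zs' = zs \<and> s' rS = S \<and> s' rM = M \<and>
    s' rA = s rA \<and> s' rZ = s rZ \<and> M \<le> j \<and> s' rJ = j \<and> s' rL = (\<Sum>j = M..<j. S div j))"
  have S: "S < 2 ^ w" using M_power_le[of 2 1] by (simp add: S_def power2_eq_square)
  have M: "4 * M < 2 ^ w" using M_power_le[of 1 4] by simp
  have small: "2 < (2::nat) ^ w" "Suc 0 < (2::nat) ^ w" using M M_pos by linarith+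
  show ?thesis
    unfolding logarithm_loop_def seq.simps wp_simps
  proof (rule wp_While[where I = I and i = M and m = "2 * M"])
    show "I M (s(rL := aval w s (Const 0), rJ := aval w (s(rL := aval w s (Const 0))) (Reg rM)), zs, cs)"
      by (simp add: I_def s word_id)
  next
    fix j c assume j: "j < 2 * M" and I: "I j c"
    then obtain s' where c: "c = (s', zs, cs)" and s': "s' rS = S" "s' rM = M" "s' rA = s rA"
      "s' rZ = s rZ" "s' rJ = j" "s' rL = (\<Sum>j = M..<j. S div j)" "M \<le> j"
      by (cases c) (auto simp: I_def)
    have "(\<Sum>j = M..<Suc j. S div j) \<le> L"
      unfolding L_def using j by (intro sum_mono2) auto
    then have "(\<Sum>j = M..<j. S div j) + S div j < 2 ^ w" "S div j < 2 ^ w"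
      using L_le S s' by simp_all
    then show "aval w (fst c) (Less (Reg rJ) (Times (Const 2) (Reg rM))) \<noteq> 0 \<and>
        wp w (Seq (Assign rL (Plus (Reg rL) (Quot (Reg rS) (Reg rJ))))
          (Seq (Assign rJ (Plus (Reg rJ) (Const 1))) Skip)) (I (Suc j)) c"
      using j M small s' by (simp add: c I_def word_id)
  next
    fix c assume "I (2 * M) c"
    then show "aval w (fst c) (Less (Reg rJ) (Times (Const 2) (Reg rM))) = 0 \<and> Q c"
      using M small Q by (cases c) (auto simp: I_def L_def word_id)
  qed simp
qed

lemma small_word: "v \<le> 64 \<Longrightarrow> word w v = v"
  using M_power_le[of 0 v] by (intro word_id) simp

lemma wp_scale_loop:
  assumes s: "s rK = k"
    and Q: "\<And>s'. s' rT = 4 ^ K \<Longrightarrow> s' rP = 2 ^ K \<Longrightarrow> s' rN = s rN \<Longrightarrow> Q (s', zs, cs)"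
  shows "wp w scale_loop Q (s, zs, cs)"
proof -
  define I where "I = (\<lambda>i (s', zs', cs'). cs' = cs \<and> zs' = zs \<and> s' rK = k \<and> s' rN = s rN \<and>
    s' rT = 4 ^ i \<and> s' rP = 2 ^ i)"
  have words: "word w 0 = 0" "word w (Suc 0) = Suc 0" "word w 2 = 2" "word w 4 = 4"
    by (simp_all add: small_word)
  have M4: "M < 2 ^ w" using M_power_le[of 1 1] by simp
  show ?thesis
    unfolding scale_loop_def seq.simps wp_simps
  proof (rule wp_While[where I = I and i = 0 and m = K])
    show "I 0 (s(rT := aval w s (Const 1), rP := aval w (s(rT := aval w s (Const 1))) (Const 1)), zs, cs)"
      by (simp add: I_def s words)
  next
    fix i c assume i: "i < K" and I: "I i c"
    have "(4::nat) ^ Suc i \<le> M" unfolding M_def using i by (intro power_increasing) auto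
    moreover have "(2::nat) ^ Suc i \<le> 4 ^ Suc i" by (intro power_mono) auto
    ultimately have "4 * 4 ^ i < (2::nat) ^ w" "2 * 2 ^ i < (2::nat) ^ w" using M4 by simp_all
    then show "aval w (fst c) (Less (Reg rT) (Reg rK)) \<noteq> 0 \<and>
        wp w (Seq (Assign rT (Times (Const 4) (Reg rT)))
          (Seq (Assign rP (Times (Const 2) (Reg rP))) Skip)) (I (Suc i)) c"
      using I K(2)[OF i] by (cases c) (simp add: I_def words word_id)
  next
    fix c assume "I K c"
    then show "aval w (fst c) (Less (Reg rT) (Reg rK)) = 0 \<and> Q c"
      using Q K(1) by (cases c) (simp add: I_def words)
  qed simp
qed

lemma wp_accuracy_loop:
  assumes s: "s rN = N"
    and Q: "\<And>s'. s' rD = 4 ^ d \<Longrightarrow> s' rF = F \<Longrightarrow> s' rT = s rT \<Longrightarrow> s' rP = s rP \<Longrightarrow> Q (s', zs, cs)"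
  shows "wp w accuracy_loop Q (s, zs, cs)"
proof -
  define I where "I = (\<lambda>i (s', zs', cs'). cs' = cs \<and> zs' = zs \<and> s' rN = N \<and> s' rT = s rT \<and>
    s' rP = s rP \<and> s' rQ = 2 ^ i \<and> s' rD = 16 * 4 ^ i \<and> s' rF = 81 + 27 * i)"
  have words: "word w 0 = 0" "word w (Suc 0) = Suc 0" "word w 2 = 2" "word w 4 = 4"
    "word w 16 = 16" "word w 27 = 27"
    by (simp_all add: small_word)
  have M4: "M < 2 ^ w" using M_power_le[of 1 1] by simp
  have F: "F < 2 ^ w"
  proof -
    have "F * 1 \<le> F * (4 ^ d * 2 ^ K)" by (intro mult_left_mono) auto
    also have "\<dots> < 2 ^ w" using Z_M_power_le[of 0 1] by (simp add: Z_def mult.assoc)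
    finally show ?thesis by simp
  qed
  \<comment> \<open>The constant 81 is beyond the range of \<open>small_word\<close>, but it is at
    most \<open>F\<close>, as d is at least 2.\<close>
  then have word81: "word w 81 = 81" by (simp add: word_def F_def d_def)
  show ?thesis
    unfolding accuracy_loop_def seq.simps wp_simps
  proof (rule wp_While[where I = I and i = 0 and m = e])
    show "I 0 (s(rQ := aval w s (Const 1), rD := aval w (s(rQ := aval w s (Const 1))) (Const 16),
        rF := aval w (s(rQ := aval w s (Const 1), rD := aval w (s(rQ := aval w s (Const 1))) (Const 16)))
          (Const 81)), zs, cs)"
      by (simp add: I_def s[simplified] words word81)
  next
    fix i c assume i: "i < e" and I: "I i c"
    have "(4::nat) ^ (Suc i + 2) \<le> M" unfolding M_def d_def using i by (intro power_increasing) auto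
    then have pow: "4 * (16 * 4 ^ i) < (2::nat) ^ w" using M4 by simp
    moreover have "(2::nat) ^ i \<le> 4 ^ i" by (intro power_mono) auto
    ultimately have "2 * 2 ^ i < (2::nat) ^ w" by linarith
    moreover have "81 + 27 * i + 27 < (2::nat) ^ w" using i F by (simp add: F_def d_def)
    ultimately show "aval w (fst c) (Less (Reg rQ) (Reg rN)) \<noteq> 0 \<and>
        wp w (Seq (Assign rQ (Times (Const 2) (Reg rQ))) (Seq (Assign rD (Times (Const 4) (Reg rD)))
          (Seq (Assign rF (Plus (Reg rF) (Const 27))) Skip))) (I (Suc i)) c"
      using I e(2)[OF i] pow by (cases c) (simp add: I_def words word_id)
  next
    fix c assume "I e c"
    then show "aval w (fst c) (Less (Reg rQ) (Reg rN)) = 0 \<and> Q c"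
      using Q e(1) by (cases c) (simp add: I_def words F_def d_def)
  qed simp
qed

lemma wp_parameter_assignments:
  assumes s: "s rT = 4 ^ K" "s rP = 2 ^ K" "s rD = 4 ^ d" "s rF = F"
    and Q: "\<And>s'. s' rX = 1 \<Longrightarrow> s' rW = 1 \<Longrightarrow> s' rR = Z \<Longrightarrow> s' rA = 0 \<Longrightarrow> s' rS = S \<Longrightarrow> s' rM = M \<Longrightarrow>
      s' rT = 4 ^ K \<Longrightarrow> s' rZ = Z \<Longrightarrow> Q (s', zs, cs)"
  shows "wp w parameter_assignments Q (s, zs, cs)"
proof -
  have Z: "F * 4 ^ d * 2 ^ K < 2 ^ w" using Z_M_power_le[of 0 1] by (simp add: Z_def)
  moreover have "F * 4 ^ d * 1 \<le> F * 4 ^ d * 2 ^ K" by (intro mult_left_mono) auto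
  then have "F * 4 ^ d < 2 ^ w" using Z by linarith
  moreover have "4 ^ K * 4 ^ d < (2::nat) ^ w" using M_power_le[of 1 1] by (simp add: M_def power_add)
  moreover have "4 ^ K * 4 ^ d * (4 ^ K * 4 ^ d) < (2::nat) ^ w"
    using M_power_le[of 2 1] by (simp add: M_def power_add power2_eq_square)
  ultimately have words: "word w (F * 4 ^ d) = F * 4 ^ d" "word w (F * 4 ^ d * 2 ^ K) = Z"
    "word w (4 ^ K * 4 ^ d) = M" "word w (M * M) = S"
    by (simp_all only: word_id Z_def M_def S_def power_add)
  have "word w 0 = 0" "word w 1 = 1" "word w (Suc 0) = 1"
    by (simp_all add: small_word)
  with words show ?thesis
    unfolding parameter_assignments_def seq.simps wp_simps by (intro Q) (simp_all add: s)
qed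

text \<open>The accumulator over S * Z estimates the entropy in nats, and L / S estimates ln 2. In
  their quotient \<open>S\<close> cancels, which leaves the denominator L * Z.\<close>

lemma wp_entropy_program:
  assumes s: "s 0 = k" "s 1 = N"
    and zs: "total_length (levels 0) \<le> length zs" "set zs \<subseteq> {..<2 ^ w}"
    and Q: "\<And>s' ys. s' 0 = total_value (\<lambda>j. S div j) (levels 0) zs \<Longrightarrow> s' 1 = L * Z \<Longrightarrow> Q (s', ys, cs)"
  shows "wp w entropy_program Q (s, zs, cs)"
  unfolding entropy_program_def seq.simps wp_simps
proof (rule wp_scale_loop, goal_cases)
  case (2 s1)
  show ?case
  proof (rule wp_accuracy_loop, goal_cases)
    case (2 s2)
    show ?case
    proof (rule wp_parameter_assignments, goal_cases)
      case (5 s3)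
      show ?case
      proof (rule wp_level_loop, goal_cases)
        case (11 s4 ys)
        show ?case
        proof (rule wp_logarithm_loop, goal_cases)
          case (3 s5)
          have "L * Z \<le> S * Z" using L_le by (intro mult_right_mono) auto
          also have "S * Z < 2 ^ w"
            using Z_M_power_le[of 2 1] by (simp add: S_def power2_eq_square mult.commute)
          finally have "word w (L * Z) = L * Z" by (rule word_id)
          then show ?case
            using 3 11 by (simp add: Q)
        qed (use 11 in auto)
      qed (use 5 zs in auto)
    qed (use 2 \<open>s1 rT = 4 ^ K\<close> \<open>s1 rP = 2 ^ K\<close> in auto)
  qed (use 2 s in auto)
qed (use s in auto)

end

section \<open>Expectation and variance\<close>

lemma expectation_bind_pmf_finite:
  fixes h :: "'b \<Rightarrow> real"
  assumes "finite (set_pmf p)" "\<And>x. x \<in> set_pmf p \<Longrightarrow> finite (set_pmf (f x))"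
  shows "measure_pmf.expectation (p \<bind> f) h = measure_pmf.expectation p (\<lambda>x. measure_pmf.expectation (f x) h)"
proof -
  \<comment> \<open>Finiteness of \<open>f x\<close> is known only on the support of
    \<open>p\<close>; a point mass elsewhere makes it hold throughout.\<close>
  let ?g = "\<lambda>x. if x \<in> set_pmf p then f x else return_pmf undefined"
  have "p \<bind> f = p \<bind> ?g" by (intro bind_pmf_cong) auto
  moreover have "measure_pmf.expectation (p \<bind> ?g) h =
      (\<Sum>x\<in>set_pmf p. pmf p x *\<^sub>R measure_pmf.expectation (?g x) h)"
    by (rule pmf_expectation_bind) (use assms in auto)
  moreover have "measure_pmf.expectation p (\<lambda>x. measure_pmf.expectation (f x) h) =
      (\<Sum>x\<in>set_pmf p. pmf p x *\<^sub>R measure_pmf.expectation (f x) h)"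
    by (rule integral_measure_pmf) (use assms in \<open>auto simp: set_pmf_iff\<close>)
  ultimately show ?thesis by simp
qed

lemma finite_set_replicate_pmf: "finite (set_pmf D) \<Longrightarrow> finite (set_pmf (replicate_pmf n D))"
  unfolding set_replicate_pmf
  by (rule finite_subset[OF _ finite_lists_length_eq[of "set_pmf D" n]]) auto

text \<open>Finite support makes every real function of the samples integrable, so that expectations
  split without side conditions.\<close>

locale finite_pmf =
  fixes D :: "nat pmf"
  assumes finite: "finite (set_pmf D)"
begin

abbreviation "E n f \<equiv> measure_pmf.expectation (replicate_pmf n D) f"

lemma integrable [simp]: "integrable (measure_pmf (replicate_pmf n D)) (f :: _ \<Rightarrow> real)"
  by (intro integrable_measure_pmf_finite finite_set_replicate_pmf finite)

text \<open>Independence of consecutive stretches of the stream, in the form of an iterated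
  expectation.\<close>

lemma E_append: "E (m + n) (f :: _ \<Rightarrow> real) = E m (\<lambda>xs. E n (\<lambda>ys. f (xs @ ys)))"
  unfolding replicate_pmf_distrib
  by (subst expectation_bind_pmf_finite; (simp add: finite_set_replicate_pmf finite)?)+

lemma E_Suc: "E (Suc n) (f :: _ \<Rightarrow> real) = measure_pmf.expectation D (\<lambda>x. E n (\<lambda>xs. f (x # xs)))"
  unfolding replicate_pmf.simps
  by (subst expectation_bind_pmf_finite; (simp add: finite_set_replicate_pmf finite)?)+

lemma E_cong: "(\<And>xs. length xs = n \<Longrightarrow> f xs = g xs) \<Longrightarrow> E n f = (E n g :: real)"
  by (intro integral_cong_AE) (auto simp: AE_measure_pmf_iff set_replicate_pmf)

text \<open>The probability that the first of \<open>j + 1\<close> samples does not occur again.\<close>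

definition q :: "nat \<Rightarrow> real" where
  "q j = measure_pmf.expectation D (\<lambda>i. (1 - pmf D i) ^ j)"

lemma E_not_in: "E m (\<lambda>ys. of_bool (i \<notin> set ys)) = (1 - pmf D i) ^ m"
proof (induction m)
  case (Suc m)
  have "E (Suc m) (\<lambda>ys. of_bool (i \<notin> set ys) :: real) =
      measure_pmf.expectation D (\<lambda>x. of_bool (x \<noteq> i) * E m (\<lambda>ys. of_bool (i \<notin> set ys)))"
    unfolding E_Suc by (intro Bochner_Integration.integral_cong refl) (auto simp: of_bool_def)
  also have "\<dots> = measure_pmf.expectation D (\<lambda>x. of_bool (x \<noteq> i)) * (1 - pmf D i) ^ m"
    by (simp only: Suc integral_mult_left_zero)
  also have "(\<lambda>x. of_bool (x \<noteq> i) :: real) = indicator (- {i})"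
    by (auto simp: indicator_def)
  also have "measure_pmf.expectation D (indicator (- {i})) = 1 - pmf D i"
    using measure_pmf.prob_compl[of "{i}" D] by (simp add: Compl_eq_Diff_UNIV measure_pmf_single)
  finally show ?case by simp
qed simp

text \<open>The samples split into the first one, the \<open>j\<close> inspected ones and a rest
  that integrates out. Given the first sample, \<open>E_not_in\<close> applies to the inspected
  ones.\<close>

lemma E_unseen:
  assumes "j < n"
  shows "E n (\<lambda>zs. of_bool (hd zs \<notin> set (take j (tl zs)))) = q j"
proof -
  obtain m where n: "n = Suc (j + m)" using assms less_iff_Suc_add by auto
  have "E n (\<lambda>zs. of_bool (hd zs \<notin> set (take j (tl zs))) :: real) =
      measure_pmf.expectation D (\<lambda>i. E j (\<lambda>xs. E m (\<lambda>ys. of_bool (i \<notin> set (take j (xs @ ys))))))"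
    unfolding n E_Suc E_append by simp
  also have "\<dots> = measure_pmf.expectation D (\<lambda>i. E j (\<lambda>xs. of_bool (i \<notin> set xs)))"
    by (intro Bochner_Integration.integral_cong refl E_cong) simp
  finally show ?thesis by (simp add: E_not_in q_def)
qed

lemma q_nonneg: "q j \<ge> 0" and q_le_1: "q j \<le> 1"
proof -
  show "q j \<ge> 0" unfolding q_def by (intro Bochner_Integration.integral_nonneg) (simp add: pmf_le_1)
  have "q j \<le> measure_pmf.expectation D (\<lambda>i. 1)"
    unfolding q_def by (intro integral_mono integrable_measure_pmf_finite finite)
      (auto simp: pmf_le_1 power_le_one)
  then show "q j \<le> 1" by simp
qed

lemma E_block_value:
  assumes "x > 0"
  shows "E (4 * x) (\<lambda>zs. real (block_value a x zs)) = (\<Sum>j = x..<4 * x. real (a j) * q j)"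
proof -
  have "E (4 * x) (\<lambda>zs. real (block_value a x zs)) =
      (\<Sum>j = x..<4 * x. real (a j) * E (4 * x) (\<lambda>zs. of_bool (hd zs \<notin> set (take j (tl zs)))))"
    unfolding block_value_def of_nat_sum of_nat_mult of_nat_of_bool
    by (subst Bochner_Integration.integral_sum) auto
  then show ?thesis by (simp add: E_unseen)
qed

text \<open>If the first sample recurs within \<open>x\<close> further ones, then all terms vanish,
  since each index is at least \<open>x\<close>; otherwise the value is at most 3 S. The factor
  \<open>q x\<close> is what keeps the variance of high levels small.\<close>

lemma E_block_value_square_le:
  assumes "x > 0"
  shows "E (4 * x) (\<lambda>zs. (real (block_value (\<lambda>j. S div j) x zs))\<^sup>2) \<le> 9 * (real S)\<^sup>2 * q x"
proof -
  have "(real (block_value (\<lambda>j. S div j) x zs))\<^sup>2 \<le>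
      9 * (real S)\<^sup>2 * of_bool (hd zs \<notin> set (take x (tl zs)))" for zs
  proof (cases "hd zs \<in> set (take x (tl zs))")
    case True
    then have "hd zs \<in> set (take j (tl zs))" if "x \<le> j" for j
      using set_take_subset_set_take[OF that, of "tl zs"] True by blast
    then have "block_value (\<lambda>j. S div j) x zs = 0"
      unfolding block_value_def by (intro sum.neutral) auto
    then show ?thesis by simp
  next
    case False
    have "(real (block_value (\<lambda>j. S div j) x zs))\<^sup>2 \<le> (real (3 * S))\<^sup>2"
      using block_value_le[OF assms] by (intro power_mono) (simp_all only: of_nat_le_iff of_nat_0_le_iff)
    then show ?thesis using False by (simp add: power_mult_distrib)
  qed
  then have "E (4 * x) (\<lambda>zs. (real (block_value (\<lambda>j. S div j) x zs))\<^sup>2) \<le>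
      E (4 * x) (\<lambda>zs. 9 * (real S)\<^sup>2 * of_bool (hd zs \<notin> set (take x (tl zs))))"
    by (intro integral_mono integrable)
  then show ?thesis using assms by (simp add: E_unseen)
qed

lemma block_value_append: "length xs = 4 * x \<Longrightarrow> block_value a x (xs @ ys) = block_value a x xs"
  unfolding block_value_def
proof (intro sum.cong refl)
  fix j assume "length xs = 4 * x" "j \<in> {x..<4 * x}"
  then have "xs \<noteq> []" "j - length (tl xs) = 0" by auto
  then show "a j * of_bool (hd (xs @ ys) \<notin> set (take j (tl (xs @ ys)))) =
      a j * of_bool (hd xs \<notin> set (take j (tl xs)))"
    by (cases xs) simp_all
qed

definition mean :: "(nat \<Rightarrow> nat) \<Rightarrow> (nat \<times> nat) list \<Rightarrow> real" where
  "mean a bs = (\<Sum>(W, x)\<leftarrow>bs. real W * (\<Sum>j = x..<4 * x. real (a j) * q j))"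

lemma E_total_value:
  assumes "\<forall>(W, x)\<in>set bs. x > 0"
  shows "E (total_length bs) (\<lambda>zs. real (total_value a bs zs)) = mean a bs"
  using assms
proof (induction bs)
  case (Cons b bs)
  obtain W x where b: "b = (W, x)" by force
  have len: "total_length (b # bs) = 4 * x + total_length bs" by (simp add: b total_length_def)
  have "E (total_length (b # bs)) (\<lambda>zs. real (total_value a (b # bs) zs)) =
      E (4 * x) (\<lambda>xs. E (total_length bs) (\<lambda>ys. real W * real (block_value a x xs) + real (total_value a bs ys)))"
    unfolding len E_append by (intro E_cong) (simp add: b block_value_append)
  also have "\<dots> = E (4 * x) (\<lambda>xs. real W * real (block_value a x xs) + mean a bs)"
    using Cons by simp
  also have "\<dots> = mean a (b # bs)"
    using Cons.prems by (simp add: E_block_value b mean_def)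
  finally show ?case .
qed (simp add: mean_def total_length_def)

text \<open>Variances of independent blocks add, and each is at most the second moment times the
  squared weight.\<close>

lemma E_total_value_variance:
  assumes "\<forall>(W, x)\<in>set bs. x > 0"
  shows "E (total_length bs) (\<lambda>zs. (real (total_value (\<lambda>j. S div j) bs zs) - mean (\<lambda>j. S div j) bs)\<^sup>2) \<le>
    9 * (real S)\<^sup>2 * (\<Sum>(W, x)\<leftarrow>bs. (real W)\<^sup>2 * q x)"
  using assms
proof (induction bs)
  case (Cons b bs)
  let ?a = "\<lambda>j. S div j"
  obtain W x where b: "b = (W, x)" by force
  have x: "x > 0" using Cons.prems by (simp add: b)
  have len: "total_length (b # bs) = 4 * x + total_length bs" by (simp add: b total_length_def)
  define \<mu> where "\<mu> = (\<Sum>j = x..<4 * x. real (?a j) * q j)"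
  define f where "f = (\<lambda>xs. real W * (real (block_value ?a x xs) - \<mu>))"
  define g where "g = (\<lambda>ys. real (total_value ?a bs ys) - mean ?a bs)"
  have Eg: "E (total_length bs) g = 0"
    using Cons.prems by (simp add: g_def E_total_value)
  have "E (total_length (b # bs)) (\<lambda>zs. (real (total_value ?a (b # bs) zs) - mean ?a (b # bs))\<^sup>2) =
      E (4 * x) (\<lambda>xs. E (total_length bs) (\<lambda>ys. (f xs)\<^sup>2 + 2 * f xs * g ys + (g ys)\<^sup>2))"
    unfolding len E_append
    by (intro E_cong) (simp add: b block_value_append f_def g_def mean_def \<mu>_def power2_eq_square algebra_simps)
  \<comment> \<open>The mixed term vanishes: \<open>f xs\<close> is constant for the inner
    expectation, and \<open>g\<close> has mean 0.\<close>
  also have "\<dots> = E (4 * x) (\<lambda>xs. (f xs)\<^sup>2 + E (total_length bs) (\<lambda>ys. (g ys)\<^sup>2))"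
    by (simp add: Eg)
  also have "\<dots> = E (4 * x) (\<lambda>xs. (f xs)\<^sup>2) + E (total_length bs) (\<lambda>ys. (g ys)\<^sup>2)"
    by simp
  also have "E (4 * x) (\<lambda>xs. (f xs)\<^sup>2) \<le> (real W)\<^sup>2 * (9 * (real S)\<^sup>2 * q x)"
  proof -
    have "E (4 * x) (\<lambda>xs. (f xs)\<^sup>2) = (real W)\<^sup>2 * E (4 * x) (\<lambda>xs. (real (block_value ?a x xs) - \<mu>)\<^sup>2)"
      by (simp add: f_def power_mult_distrib)
    also have "E (4 * x) (\<lambda>xs. (real (block_value ?a x xs) - \<mu>)\<^sup>2) =
        E (4 * x) (\<lambda>xs. (real (block_value ?a x xs))\<^sup>2) - \<mu>\<^sup>2"
      using measure_pmf.variance_eq[of "replicate_pmf (4 * x) D" "\<lambda>xs. real (block_value ?a x xs)"] x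
      by (simp add: E_block_value \<mu>_def)
    also have "\<dots> \<le> 9 * (real S)\<^sup>2 * q x"
      using E_block_value_square_le[OF x, of S] by (smt (verit) zero_le_power2)
    finally show ?thesis by (simp add: mult_left_mono)
  qed
  also have "E (total_length bs) (\<lambda>ys. (g ys)\<^sup>2) \<le> 9 * (real S)\<^sup>2 * (\<Sum>(W, x)\<leftarrow>bs. (real W)\<^sup>2 * q x)"
    using Cons unfolding g_def by simp
  finally show ?case by (simp add: b algebra_simps)
qed (simp add: mean_def total_length_def)

end

section \<open>Approximation of entropy and logarithm\<close>

text \<open>The powers of 1 - p decrease, so j + 1 copies of the last term are at most the geometric
  sum, which equals 1 - (1 - p)^(j + 1).\<close>

lemma geometric_mass_le:
  fixes p :: real
  assumes "0 \<le> p" "p \<le> 1"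
  shows "p * (1 - p) ^ j \<le> 1 / (real j + 1)"
proof -
  have "(real j + 1) * (p * (1 - p) ^ j) = (\<Sum>i<Suc j. p * (1 - p) ^ j)" by (simp add: algebra_simps)
  also have "\<dots> \<le> (\<Sum>i<Suc j. p * (1 - p) ^ i)"
    using assms by (intro sum_mono mult_left_mono power_decreasing) auto
  also have "\<dots> = 1 - (1 - p) ^ Suc j"
    using one_diff_power_eq[of "1 - p" "Suc j"] by (simp only: sum_distrib_left) simp
  also have "\<dots> \<le> 1" using assms by simp
  finally show ?thesis by (simp add: field_simps)
qed

text \<open>The tail of the logarithm series is nonnegative, and by \<open>geometric_mass_le\<close>
  its terms are at most 1 / (j (j + 1)), which telescopes to 1 / M.\<close>

lemma entropy_term_truncation:
  fixes p :: real
  assumes p: "0 \<le> p" "p \<le> 1" and M: "M \<ge> 1"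
  shows "\<bar>p * ln (1 / p) - (\<Sum>j = 1..<M. p * (1 - p) ^ j / real j)\<bar> \<le> 1 / real M"
proof (cases "p = 0")
  case False
  let ?f = "\<lambda>j. p * (1 - p) ^ j / real j"
  have "(\<lambda>n. - ((- (p - 1)) ^ n) / of_nat n) sums ln (1 + (p - 1))"
    using p False by (intro ln_series') auto
  from sums_mult[OF this, of "- p"] have "?f sums (p * ln (1 / p))"
    using p False by (simp add: ln_div)
  then have tail: "(\<lambda>j. ?f (j + M)) sums (p * ln (1 / p) - (\<Sum>j<M. ?f j))"
    by (rule sums_split_initial_segment)
  have tele: "(\<lambda>j. 1 / real (j + M) - 1 / real (Suc j + M)) sums (1 / real (0 + M) - 0)"
    by (rule telescope_sums') (use LIMSEQ_ignore_initial_segment[OF lim_1_over_n] in simp)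
  have le: "?f (j + M) \<le> 1 / real (j + M) - 1 / real (Suc j + M)" for j
  proof -
    have "?f (j + M) \<le> 1 / (real (j + M) + 1) / real (j + M)"
      using p by (intro divide_right_mono geometric_mass_le) auto
    also have "\<dots> = 1 / real (j + M) - 1 / real (Suc j + M)"
      using M by (simp add: field_simps)
    finally show ?thesis .
  qed
  have "p * ln (1 / p) - (\<Sum>j<M. ?f j) \<le> 1 / real (0 + M) - 0"
    by (rule sums_le[OF le tail tele])
  moreover have "0 \<le> p * ln (1 / p) - (\<Sum>j<M. ?f j)"
    by (rule sums_le[OF _ sums_zero tail]) (use p in simp)
  \<comment> \<open>The term at index 0 is 0, since division by 0 yields 0.\<close>
  moreover have "(\<Sum>j<M. ?f j) = (\<Sum>j = 1..<M. ?f j)"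
    by (rule sum.mono_neutral_right) auto
  ultimately show ?thesis by simp
qed simp

text \<open>The upper bound follows from ln x <= x - 1. It is crude, but it will only be multiplied
  by an error of order 1 / M, and M is at least k * 4^d.\<close>

lemma entropy_term_bounds:
  fixes p :: real
  assumes "0 \<le> p" "p \<le> 1"
  shows "0 \<le> p * ln (1 / p)" "p * ln (1 / p) \<le> 1"
proof -
  show "0 \<le> p * ln (1 / p)"
    using assms by (cases "p = 0") (auto intro!: mult_nonneg_nonneg ln_ge_zero)
  show "p * ln (1 / p) \<le> 1"
  proof (cases "p = 0")
    case False
    have "p * ln (1 / p) \<le> p * (1 / p - 1)"
      using assms False by (intro mult_left_mono ln_le_minus_one) auto
    also have "\<dots> \<le> 1" using assms False by (simp add: field_simps)
    finally show ?thesis .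
  qed simp
qed

text \<open>Rounding down loses at most 1 before scaling. The bounds include \<open>j\<close> = 0,
  where both quotients by \<open>j\<close> are 0.\<close>

lemma floor_quotient_bounds:
  assumes "S > 0"
  shows "real (S div j) / real S \<le> 1 / real j" "1 / real j - 1 / real S \<le> real (S div j) / real S"
proof -
  have "real (S div j) \<le> real S / real j"
    using of_nat_div_le_of_nat[of S j] by simp
  then show "real (S div j) / real S \<le> 1 / real j"
    using assms by (simp add: divide_simps mult.commute split: if_splits)
  have "real S / real j - 1 \<le> real (S div j)"
    using floor_divide_of_nat_eq[of S j, where 'a = real] by linarith
  then have "(real S / real j - 1) / real S \<le> real (S div j) / real S"
    by (intro divide_right_mono) auto
  then show "1 / real j - 1 / real S \<le> real (S div j) / real S"
    using assms by (simp add: diff_divide_distrib)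
qed

text \<open>The increment of ln from j to j + 1 lies between 1 / (j + 1) and 1 / j, and the
  increments telescope to ln 2. Shifting the index by one changes the harmonic sum by 1 / M - 1 / (2
  M).\<close>

lemma ln_2_harmonic_bounds:
  assumes "M > 0"
  shows "ln 2 \<le> (\<Sum>j = M..<2 * M. 1 / real j)" "(\<Sum>j = M..<2 * M. 1 / real j) \<le> ln 2 + 1 / real M"
proof -
  have ln_step: "ln (real (Suc j)) - ln (real j) \<le> 1 / real j"
    "1 / real (Suc j) \<le> ln (real (Suc j)) - ln (real j)" if "j \<ge> M" for j
  proof -
    have j: "real j > 0" using that assms by simp
    have "ln (real (Suc j) / real j) \<le> real (Suc j) / real j - 1"
      using j by (intro ln_le_minus_one) auto
    then show "ln (real (Suc j)) - ln (real j) \<le> 1 / real j"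
      using j by (simp add: ln_div field_simps)
    have "ln (real j / real (Suc j)) \<le> real j / real (Suc j) - 1"
      using j by (intro ln_le_minus_one) auto
    then show "1 / real (Suc j) \<le> ln (real (Suc j)) - ln (real j)"
      using j by (simp add: ln_div field_simps)
  qed
  have tele: "(\<Sum>j = M..<2 * M. ln (real (Suc j)) - ln (real j)) = ln 2"
    using assms by (subst sum_Suc_diff') (auto simp: ln_mult)
  have "(\<Sum>j = M..<2 * M. ln (real (Suc j)) - ln (real j)) \<le> (\<Sum>j = M..<2 * M. 1 / real j)"
    by (intro sum_mono ln_step) auto
  then show "ln 2 \<le> (\<Sum>j = M..<2 * M. 1 / real j)" by (simp only: tele)
  have "(\<Sum>j = M..<2 * M. 1 / real (Suc j)) \<le> (\<Sum>j = M..<2 * M. ln (real (Suc j)) - ln (real j))"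
    by (intro sum_mono ln_step) auto
  moreover have "(\<Sum>j = M..<2 * M. 1 / real (Suc j) - 1 / real j) = 1 / real (2 * M) - 1 / real M"
    by (subst sum_Suc_diff') auto
  then have "(\<Sum>j = M..<2 * M. 1 / real j) =
      (\<Sum>j = M..<2 * M. 1 / real (Suc j)) + 1 / real M - 1 / real (2 * M)"
    unfolding sum_subtractf by linarith
  ultimately show "(\<Sum>j = M..<2 * M. 1 / real j) \<le> ln 2 + 1 / real M"
    unfolding tele by (smt (verit) of_nat_0_le_iff divide_nonneg_nonneg)
qed

text \<open>For the passage from nats to bits: \<open>l\<close> will be ln 2 and \<open>v\<close>
  its approximation. The factors are 2 = 1 / (1/2) and 3 = 1 / (1/2 * 2/3).\<close>

lemma quotient_perturbation:
  fixes x y h v l :: real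
  assumes "\<bar>y - h\<bar> \<le> x" "0 \<le> h" "h \<le> m" "\<bar>v - l\<bar> \<le> r" "1 / 2 \<le> v" "2 / 3 \<le> l"
  shows "\<bar>y / v - h / l\<bar> \<le> 2 * x + 3 * m * r"
proof -
  have pos: "v > 0" "l > 0" using assms by linarith+
  have "y / v - h / l = (y - h) / v + h * ((l - v) / (v * l))"
    using pos by (simp add: field_simps)
  also have "\<bar>\<dots>\<bar> \<le> \<bar>y - h\<bar> / v + h * (\<bar>v - l\<bar> / (v * l))"
    using pos assms by (intro abs_triangle_ineq[THEN order_trans]) (simp add: abs_mult abs_minus_commute)
  also have "\<bar>y - h\<bar> / v \<le> x / (1 / 2)"
    using assms by (intro frac_le) auto
  also have "h * (\<bar>v - l\<bar> / (v * l)) \<le> m * (r / (1 / 2 * (2 / 3)))"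
    using assms pos by (intro mult_mono frac_le) auto
  finally show ?thesis by simp
qed

section \<open>Accuracy of the estimate\<close>

text \<open>The distribution enters only here: the number of samples is defined in
  \<open>parameters\<close> and must not depend on it.\<close>

locale estimation = parameters k N K e w + finite_pmf D for k N K e w D +
  fixes \<epsilon> :: real
  assumes support: "set_pmf D \<subseteq> {1..k}" and k_pos: "k \<ge> 1"
    and \<epsilon>: "0 < \<epsilon>" "\<epsilon> < 1" and N: "1 / \<epsilon> \<le> real N"
begin

definition entropy_nats :: real where
  "entropy_nats = (\<Sum>i = 1..k. pmf D i * ln (1 / pmf D i))"

lemma q_eq: "q j = (\<Sum>i = 1..k. pmf D i * (1 - pmf D i) ^ j)"
  unfolding q_def using support by (subst integral_measure_pmf[of "{1..k}"]) auto

lemma entropy_truncation: "\<bar>entropy_nats - (\<Sum>j = 1..<M. q j / real j)\<bar> \<le> real k / real M"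
proof -
  let ?t = "\<lambda>i. pmf D i * ln (1 / pmf D i) - (\<Sum>j = 1..<M. pmf D i * (1 - pmf D i) ^ j / real j)"
  have "entropy_nats - (\<Sum>j = 1..<M. q j / real j) = (\<Sum>i = 1..k. ?t i)"
    unfolding q_eq sum_divide_distrib sum_subtractf entropy_nats_def by (subst sum.swap) simp
  also have "\<bar>\<dots>\<bar> \<le> (\<Sum>i = 1..k. \<bar>?t i\<bar>)" by (rule sum_abs)
  also have "\<dots> \<le> (\<Sum>i = 1..k. 1 / real M)"
    using M_pos by (intro sum_mono entropy_term_truncation) (auto simp: pmf_le_1)
  finally show ?thesis by simp
qed

lemma entropy_nats_bounds: "0 \<le> entropy_nats" "entropy_nats \<le> real k"
proof -
  show "0 \<le> entropy_nats"
    unfolding entropy_nats_def by (intro sum_nonneg entropy_term_bounds) (auto simp: pmf_le_1)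
  have "entropy_nats \<le> (\<Sum>i = 1..k. 1)"
    unfolding entropy_nats_def by (intro sum_mono entropy_term_bounds) (auto simp: pmf_le_1)
  then show "entropy_nats \<le> real k" by simp
qed

lemma q_le: "x > 0 \<Longrightarrow> q x \<le> real k / real x"
proof -
  assume x: "x > 0"
  have "q x \<le> (\<Sum>i = 1..k. 1 / (real x + 1))"
    unfolding q_eq by (intro sum_mono geometric_mass_le) (auto simp: pmf_le_1)
  also have "\<dots> \<le> real k / real x" using x by (simp add: field_simps)
  finally show ?thesis .
qed

text \<open>Below level \<open>K\<close> the weight is 2^l and \<open>q\<close> is at most 1. From
  \<open>K\<close> on, the growth 4^(l - K) of the weight is compensated by \<open>q_le\<close> and
  k <= 4^K.\<close>

lemma W_q_le: "real (W l) * q (4 ^ l) \<le> (if l < K then 2 ^ l else 2 ^ K)"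
proof (cases "l < K")
  case True
  then show ?thesis using q_le_1[of "4 ^ l"] by (simp add: W_def)
next
  case False
  have "real k \<le> 4 ^ K" using K(1) by (metis of_nat_le_iff of_nat_numeral of_nat_power)
  have "real (W l) * q (4 ^ l) \<le> 2 ^ K * 4 ^ (l - K) * (real k / 4 ^ l)"
    using False q_le[of "4 ^ l"] by (intro mult_mono) (auto simp: W_def q_nonneg)
  also have "\<dots> \<le> 2 ^ K * 4 ^ (l - K) * (4 ^ K / 4 ^ l)"
    using \<open>real k \<le> 4 ^ K\<close> by (intro mult_left_mono divide_right_mono) auto
  also have "\<dots> = 2 ^ K"
    using False power_add[of "4::real" "l - K" K] by (simp add: field_simps)
  finally show ?thesis using False by simp
qed

end

section \<open>Geometric sums over the levels and the number of samples\<close>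

context parameters
begin

text \<open>The levels below \<open>K\<close> sum to less than 2^K, and each of the \<open>n\<close>
  others adds 2^K. The same sum controls both the variance and the number of samples.\<close>

lemma sum_cap_le: "(\<Sum>l < K + n. if l < K then 2 ^ l else 2 ^ K) \<le> (real n + 1) * 2 ^ K"
proof (induction n)
  case 0
  have "(\<Sum>l < K. if l < K then 2 ^ l else 2 ^ K) = (\<Sum>l < K. 2 ^ l :: real)" by simp
  also have "\<dots> = 2 ^ K - 1" by (induction K) auto
  finally show ?case by simp
qed (simp add: algebra_simps)

lemma total_length_levels:
  "l \<le> K + d \<Longrightarrow> total_length (levels l) = (\<Sum>l = l..<K + d. R l * (4 * 4 ^ l))"
proof (induction rule: inc_induct)
  case base
  then show ?case by (simp add: levels_def total_length_def)
next
  case (step n)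
  then show ?case by (simp add: levels_Cons level_def sum.atLeast_Suc_lessThan)
qed

lemma R_power_le: "real (R l * (4 * 4 ^ l)) \<le>
    4 * real F * 4 ^ d * 2 ^ K * (if l < K then 2 ^ l else 2 ^ K)" if "l < K + d"
proof (cases "l < K")
  case True
  have "real (R l * (4 * 4 ^ l)) = 4 * real F * 4 ^ d * (2 ^ (K - l) * 4 ^ l)"
    using True by (simp add: R_def)
  also have "(4::real) ^ l = 2 ^ l * 2 ^ l" by (simp flip: power_mult_distrib)
  also have "(2::real) ^ (K - l) * (2 ^ l * 2 ^ l) = 2 ^ K * 2 ^ l"
    using True by (simp flip: power_add)
  finally show ?thesis using True by simp
next
  case False
  have "(4::real) ^ (d - (l - K)) * 4 ^ l = 4 ^ d * 4 ^ K"
    using False that by (simp flip: power_add)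
  then have "real (R l * (4 * 4 ^ l)) = 4 * real F * (4 ^ d * 4 ^ K)"
    using False by (simp add: R_def)
  also have "(4::real) ^ K = 2 ^ K * 2 ^ K" by (simp flip: power_mult_distrib)
  finally show ?thesis using False by simp
qed

text \<open>One factor e + 3 = d + 1 comes from the number of levels from \<open>K\<close> on, the
  other from \<open>F\<close>, which offsets the same factor in the variance.\<close>

lemma total_length_le: "real (total_length (levels 0)) \<le> 108 * (real e + 3)\<^sup>2 * (4 ^ d * 4 ^ K)"
proof -
  have "real (total_length (levels 0)) = (\<Sum>l<K + d. real (R l * (4 * 4 ^ l)))"
    by (simp add: total_length_levels atLeast0LessThan)
  also have "\<dots> \<le> (\<Sum>l<K + d. 4 * real F * 4 ^ d * 2 ^ K * (if l < K then 2 ^ l else 2 ^ K))"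
    by (intro sum_mono R_power_le) auto
  also have "\<dots> = 4 * real F * 4 ^ d * 2 ^ K * (\<Sum>l<K + d. if l < K then 2 ^ l else 2 ^ K)"
    by (rule sum_distrib_left[symmetric])
  also have "\<dots> \<le> 4 * real F * 4 ^ d * 2 ^ K * ((real d + 1) * 2 ^ K)"
    by (intro mult_left_mono sum_cap_le) auto
  also have "\<dots> = 108 * (real e + 3)\<^sup>2 * (4 ^ d * (2 ^ K * 2 ^ K))"
    by (simp add: F_def d_def power2_eq_square algebra_simps)
  also have "(2::real) ^ K * 2 ^ K = 4 ^ K" by (simp flip: power_mult_distrib)
  finally show ?thesis .
qed

end

section \<open>Deviation from the mean and total error of the estimate\<close>

context estimation
begin

text \<open>By \<open>R_W\<close> each level has total weight \<open>Z\<close>, and the intervals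
  from 4^l to 4^(l + 1) tile the range up to \<open>M\<close>.\<close>

lemma mean_levels:
  "l \<le> K + d \<Longrightarrow> mean a (levels l) = real Z * (\<Sum>j = 4 ^ l..<M. real (a j) * q j)"
proof (induction rule: inc_induct)
  case base
  then show ?case by (simp add: levels_def mean_def M_def)
next
  case (step n)
  have "mean a (levels n) = real (R n) * (real (W n) * (\<Sum>j = 4 ^ n..<4 * 4 ^ n. real (a j) * q j)) + mean a (levels (Suc n))"
    using step by (simp add: levels_Cons level_def mean_def sum_list_replicate)
  also have "real (R n) * (real (W n) * (\<Sum>j = 4 ^ n..<4 * 4 ^ n. real (a j) * q j)) =
      real Z * (\<Sum>j = 4 ^ n..<4 * 4 ^ n. real (a j) * q j)"
    using R_W[of n] step by (simp flip: of_nat_mult mult.assoc)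
  also have "\<dots> + mean a (levels (Suc n)) = real Z * ((\<Sum>j = 4 ^ n..<4 ^ Suc n. real (a j) * q j) +
      (\<Sum>j = 4 ^ Suc n..<M. real (a j) * q j))"
    using step by (simp add: distrib_left)
  also have "(\<Sum>j = 4 ^ n..<4 ^ Suc n. real (a j) * q j) + (\<Sum>j = 4 ^ Suc n..<M. real (a j) * q j) =
      (\<Sum>j = 4 ^ n..<M. real (a j) * q j)"
  proof (rule sum.atLeastLessThan_concat)
    show "(4::nat) ^ Suc n \<le> M" unfolding M_def using step by (intro power_increasing) auto
  qed simp
  finally show ?case .
qed

lemma variance_levels:
  "l \<le> K + d \<Longrightarrow> (\<Sum>(W, x)\<leftarrow>levels l. (real W)\<^sup>2 * q x) =
    real Z * (\<Sum>l = l..<K + d. real (W l) * q (4 ^ l))"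
proof (induction rule: inc_induct)
  case base
  then show ?case by (simp add: levels_def)
next
  case (step n)
  have "real (R n) * ((real (W n))\<^sup>2 * q (4 ^ n)) = real Z * (real (W n) * q (4 ^ n))"
    using R_W[of n] step by (simp add: power2_eq_square flip: of_nat_mult mult.assoc)
  then show ?case using step
    by (simp add: levels_Cons level_def sum_list_replicate sum.atLeast_Suc_lessThan distrib_left)
qed

abbreviation "n \<equiv> total_length (levels 0)"
abbreviation "X \<equiv> total_value (\<lambda>j. S div j) (levels 0)"
abbreviation "\<mu> \<equiv> mean (\<lambda>j. S div j) (levels 0)"

lemma levels_pos: "\<forall>(W, x)\<in>set (levels l). x > 0"
  by (auto simp: levels_def level_def split: if_splits)

lemma variance_le: "E n (\<lambda>zs. (real (X zs) - \<mu>)\<^sup>2) \<le> 9 * (real S)\<^sup>2 * real Z * ((real d + 1) * 2 ^ K)"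
proof -
  have "E n (\<lambda>zs. (real (X zs) - \<mu>)\<^sup>2) \<le> 9 * (real S)\<^sup>2 * (\<Sum>(W, x)\<leftarrow>levels 0. (real W)\<^sup>2 * q x)"
    by (rule E_total_value_variance[OF levels_pos])
  also have "(\<Sum>(W, x)\<leftarrow>levels 0. (real W)\<^sup>2 * q x) = real Z * (\<Sum>l<K + d. real (W l) * q (4 ^ l))"
    by (simp add: variance_levels atLeast0LessThan)
  also have "(\<Sum>l<K + d. real (W l) * q (4 ^ l)) \<le> (\<Sum>l<K + d. if l < K then 2 ^ l else 2 ^ K)"
    by (intro sum_mono W_q_le)
  also have "\<dots> \<le> (real d + 1) * 2 ^ K" by (rule sum_cap_le)
  finally show ?thesis by (simp add: mult.assoc mult_left_mono)
qed

text \<open>The summand 2 in d = e + 2 provides the factor 16, and 2^e >= N >= 1 /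
  \<epsilon>.\<close>

lemma accuracy: "1 \<le> (2 ^ e * \<epsilon>)\<^sup>2" "16 / 4 ^ d \<le> \<epsilon>\<^sup>2" "16 / 4 ^ d \<le> \<epsilon>"
proof -
  have "1 / \<epsilon> \<le> 2 ^ e" using N e(1) by (metis of_nat_le_iff of_nat_numeral of_nat_power order_trans)
  then have "1 \<le> 2 ^ e * \<epsilon>" using \<epsilon> by (simp add: field_simps)
  then show 1: "1 \<le> (2 ^ e * \<epsilon>)\<^sup>2" by (simp add: one_le_power)
  have "(4::real) ^ e = (2 ^ e)\<^sup>2" by (simp add: power2_eq_square flip: power_mult_distrib)
  then show 2: "16 / 4 ^ d \<le> \<epsilon>\<^sup>2"
    using 1 by (simp add: d_def power_mult_distrib field_simps)
  have "\<epsilon>\<^sup>2 \<le> \<epsilon>" using \<epsilon> by (simp add: power2_eq_square mult_le_cancel_left1)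
  with 2 show "16 / 4 ^ d \<le> \<epsilon>" by linarith
qed

lemma S_pos: "S > 0" using M_pos by (simp add: S_def)

text \<open>Chebyshev's inequality. The bound is 9 * 16 / 27 = 16 / 3 times 1 / (4^d *
  \<epsilon>^2), since \<open>F\<close> cancels the factor d + 1 of the variance;
  \<open>accuracy\<close> turns this into 1 / 3 and so explains the constant 27.\<close>

lemma deviation:
  "measure_pmf.prob (replicate_pmf n D) {zs. real S * real Z * (\<epsilon> / 4) \<le> \<bar>real (X zs) - \<mu>\<bar>} \<le> 1 / 3"
proof -
  let ?p = "replicate_pmf n D" and ?t = "real S * real Z * (\<epsilon> / 4)"
  have t: "?t > 0" using S_pos Z_pos \<epsilon> by simp
  have "measure_pmf.prob ?p {zs. ?t \<le> \<bar>real (X zs) - \<mu>\<bar>} \<le> E n (\<lambda>zs. (real (X zs) - \<mu>)\<^sup>2) / ?t\<^sup>2"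
    using measure_pmf.Chebyshev_inequality[of "\<lambda>zs. real (X zs)" ?p ?t] t
    by (simp add: E_total_value[OF levels_pos])
  also have "\<dots> \<le> 9 * (real S)\<^sup>2 * real Z * ((real d + 1) * 2 ^ K) / ?t\<^sup>2"
    by (intro divide_right_mono variance_le) simp
  also have "\<dots> = 144 * ((real d + 1) * 2 ^ K) / (real Z * \<epsilon>\<^sup>2)"
    using S_pos Z_pos \<epsilon> by (simp add: field_simps power2_eq_square)
  also have "\<dots> = 144 * ((real d + 1) * 2 ^ K) / (27 * (real d + 1) * 4 ^ d * 2 ^ K * \<epsilon>\<^sup>2)"
    by (simp add: Z_def F_def add.commute)
  also have "\<dots> = (16 / 4 ^ d / \<epsilon>\<^sup>2) / 3"
    using \<epsilon> by (simp add: divide_simps)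
  also have "\<dots> \<le> 1 / 3" using accuracy(2) \<epsilon> by (simp add: divide_le_eq)
  finally show ?thesis .
qed

text \<open>The harmonic sum overshoots ln 2 by at most 1 / M, and rounding \<open>M\<close> terms
  lowers it by at most M / S = 1 / M. The errors have opposite signs, so they do not add up.\<close>

lemma logarithm_bounds: "\<bar>real L / real S - ln 2\<bar> \<le> 1 / real M"
proof -
  have eq: "real L / real S = (\<Sum>j = M..<2 * M. real (S div j) / real S)"
    by (simp add: L_def sum_divide_distrib)
  have "(\<Sum>j = M..<2 * M. real (S div j) / real S) \<le> (\<Sum>j = M..<2 * M. 1 / real j)"
    by (intro sum_mono floor_quotient_bounds S_pos)
  moreover have "(\<Sum>j = M..<2 * M. 1 / real j - 1 / real S) \<le> (\<Sum>j = M..<2 * M. real (S div j) / real S)"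
    by (intro sum_mono floor_quotient_bounds S_pos)
  moreover have "(\<Sum>j = M..<2 * M. 1 / real j - 1 / real S) = (\<Sum>j = M..<2 * M. 1 / real j) - 1 / real M"
    using M_pos by (simp add: sum_subtractf S_def)
  ultimately show ?thesis using ln_2_harmonic_bounds[OF M_pos] unfolding eq by linarith
qed

lemma mean_bounds: "\<bar>\<mu> / (real S * real Z) - (\<Sum>j = 1..<M. q j / real j)\<bar> \<le> 1 / real M"
proof -
  have "\<mu> / (real S * real Z) - (\<Sum>j = 1..<M. q j / real j) =
      (\<Sum>j = 1..<M. real (S div j) * q j) / real S - (\<Sum>j = 1..<M. q j / real j)"
    using mean_levels[of 0] Z_pos by (simp add: field_simps)
  also have "\<dots> = (\<Sum>j = 1..<M. (real (S div j) / real S - 1 / real j) * q j)"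
    by (simp add: sum_divide_distrib left_diff_distrib sum_subtractf)
  also have "\<bar>\<dots>\<bar> \<le> (\<Sum>j = 1..<M. \<bar>(real (S div j) / real S - 1 / real j) * q j\<bar>)" by (rule sum_abs)
  also have "\<dots> \<le> (\<Sum>j = 1..<M. 1 / real S)"
  proof (rule sum_mono)
    fix j
    have "\<bar>real (S div j) / real S - 1 / real j\<bar> * \<bar>q j\<bar> \<le> 1 / real S * 1"
      using floor_quotient_bounds[OF S_pos, of j] q_nonneg[of j] q_le_1[of j] by (intro mult_mono) auto
    then show "\<bar>(real (S div j) / real S - 1 / real j) * q j\<bar> \<le> 1 / real S" by (simp add: abs_mult)
  qed
  also have "\<dots> \<le> 1 / real M" using M_pos by (simp add: S_def field_simps)
  finally show ?thesis .
qed

text \<open>Error budget in nats: \<epsilon>/4 for the deviation, \<delta> for rounded coefficients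
  and \<delta> for truncation. Conversion to bits at most doubles this and adds 3 k / M <= 3
  \<delta>. In total \<epsilon>/2 + 7 \<delta>, with \<delta> <= \<epsilon>/16.\<close>

lemma estimate:
  assumes "\<bar>real x - \<mu>\<bar> < real S * real Z * (\<epsilon> / 4)"
  shows "\<bar>real x / real (L * Z) - shannon_entropy k D\<bar> \<le> \<epsilon>"
proof -
  define \<delta> :: real where "\<delta> = 1 / 4 ^ d"
  have "real k \<le> 4 ^ K" using K(1) by (metis of_nat_le_iff of_nat_numeral of_nat_power)
  then have kM: "real k / real M \<le> \<delta>" by (simp add: M_def power_add \<delta>_def field_simps)
  have "1 / real M \<le> real k / real M" using k_pos by (simp add: divide_right_mono)
  with kM have M: "1 / real M \<le> \<delta>" by linarith
  have "16 * \<delta> \<le> \<epsilon>" using accuracy(3) by (simp add: \<delta>_def)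
  then have \<delta>: "\<delta> \<le> \<epsilon> / 16" "\<delta> \<le> 1 / 16" using \<epsilon> by simp_all
  have SZ: "real S * real Z > 0" using S_pos Z_pos by simp
  have "\<bar>real x / (real S * real Z) - \<mu> / (real S * real Z)\<bar> \<le> \<epsilon> / 4"
    unfolding diff_divide_distrib[symmetric] abs_divide abs_of_pos[OF SZ] pos_divide_le_eq[OF SZ]
    using assms by (simp add: mult.commute)
  then have "\<bar>real x / (real S * real Z) - entropy_nats\<bar> \<le> \<epsilon> / 4 + 2 * \<delta>"
    using mean_bounds entropy_truncation kM M by linarith
  moreover have "2 / 3 \<le> ln (2::real)" by (rule ln2_ge_two_thirds)
  moreover from this have "1 / 2 \<le> real L / real S" using logarithm_bounds M \<delta> by linarith
  ultimately have "\<bar>real x / (real S * real Z) / (real L / real S) - entropy_nats / ln 2\<bar> \<le>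
      2 * (\<epsilon> / 4 + 2 * \<delta>) + 3 * real k * (1 / real M)"
    using entropy_nats_bounds logarithm_bounds by (intro quotient_perturbation)
  also have "\<dots> = \<epsilon> / 2 + 4 * \<delta> + 3 * (real k / real M)" by simp
  also have "\<dots> \<le> \<epsilon>" using kM \<delta> \<epsilon>(1) by linarith
  also have "real x / (real S * real Z) / (real L / real S) = real x / real (L * Z)"
    using S_pos by simp
  also have "entropy_nats / ln 2 = shannon_entropy k D"
    by (simp add: entropy_nats_def shannon_entropy_def log_def sum_divide_distrib)
  finally show ?thesis .
qed

lemma registers: "word w k = k" "word w N = N"
proof -
  have "(4::nat) ^ K \<le> M" unfolding M_def by (intro power_increasing) auto
  moreover have "(4::nat) ^ e \<le> M" unfolding M_def d_def by (intro power_increasing) auto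
  moreover have "(2::nat) ^ e \<le> 4 ^ e" by (intro power_mono) auto
  moreover have "M < 2 ^ w" using M_power_le[of 1 1] by simp
  ultimately have "k < 2 ^ w" "N < 2 ^ w" using K(1) e(1) by linarith+
  then show "word w k = k" "word w N = N" by (simp_all add: word_id)
qed

lemma returns_estimate:
  assumes N_eq: "N = nat \<lceil>1 / \<epsilon>\<rceil>"
    and zs: "zs \<in> set_pmf (replicate_pmf n D)"
  shows "returns w entropy_program k \<epsilon> zs cs (real (X zs) / real (L * Z))"
proof -
  have "set zs \<subseteq> {..k}" "length zs = n"
    using zs support by (auto simp: set_replicate_pmf)
  moreover have "k < 2 ^ w" using registers(1) by (metis mod_less_divisor word_def zero_less_numeral zero_less_power)
  ultimately have zs': "set zs \<subseteq> {..<2 ^ w}" "n \<le> length zs" by auto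
  have "wp w entropy_program (\<lambda>(s, _, _). s 0 = X zs \<and> s 1 = L * Z) (initial_registers w k \<epsilon>, zs, cs)"
    using registers zs' by (intro wp_entropy_program) (auto simp: initial_registers_def N_eq)
  then show ?thesis unfolding wp_def returns_def by fastforce
qed

lemma success_probability:
  assumes "N = nat \<lceil>1 / \<epsilon>\<rceil>"
  shows "measure_pmf.prob (samples_and_coins n 0 D)
    {(xs, cs). \<exists>h. returns w entropy_program k \<epsilon> xs cs h \<and> \<bar>h - shannon_entropy k D\<bar> \<le> \<epsilon>} \<ge> 2 / 3"
    (is "measure_pmf.prob _ ?G \<ge> _")
proof -
  let ?p = "replicate_pmf n D"
  let ?bad = "{zs. real S * real Z * (\<epsilon> / 4) \<le> \<bar>real (X zs) - \<mu>\<bar>}"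
  have "2 / 3 \<le> 1 - measure_pmf.prob ?p ?bad" using deviation by linarith
  also have "\<dots> = measure_pmf.prob ?p (UNIV - ?bad)"
    using measure_pmf.prob_compl[of ?bad ?p] by simp
  \<comment> \<open>A run is only known to return a result on lists of the right length whose
    samples fit into words, hence the restriction to the support.\<close>
  also have "\<dots> = measure_pmf.prob ?p ((UNIV - ?bad) \<inter> set_pmf ?p)"
    by (rule measure_Int_set_pmf[symmetric])
  also have "\<dots> \<le> measure_pmf.prob ?p ((\<lambda>xs. (xs, [])) -` ?G)"
  proof (intro measure_pmf.finite_measure_mono subsetI)
    fix zs assume zs: "zs \<in> (UNIV - ?bad) \<inter> set_pmf ?p"
    then have "\<bar>real (X zs) / real (L * Z) - shannon_entropy k D\<bar> \<le> \<epsilon>"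
      by (intro estimate) (simp add: not_le)
    moreover have "returns w entropy_program k \<epsilon> zs [] (real (X zs) / real (L * Z))"
      using zs by (intro returns_estimate[OF assms]) simp
    ultimately show "zs \<in> (\<lambda>xs. (xs, [])) -` ?G" by blast
  qed simp
  also have "\<dots> = measure_pmf.prob (samples_and_coins n 0 D) ?G"
    by (simp add: samples_and_coins_def pair_return_pmf2)
  finally show ?thesis .
qed

end

section \<open>Choice of the parameters, word length and sample bound\<close>

lemma Least_power_bounds:
  fixes b v :: nat
  assumes "b \<ge> 2" "v \<ge> 1"
  defines "i \<equiv> LEAST i. v \<le> b ^ i"
  shows "v \<le> b ^ i" "\<And>j. j < i \<Longrightarrow> b ^ j < v" "b ^ i \<le> b * v"
proof -
  have "v < b ^ v" using assms(1) by (intro power_gt_expt) auto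
  then show "v \<le> b ^ i"
    using LeastI[of "\<lambda>i. v \<le> b ^ i" v] by (simp add: i_def)
  show 2: "b ^ j < v" if "j < i" for j
    using not_less_Least[of j "\<lambda>i. v \<le> b ^ i"] that unfolding i_def by (simp add: not_le)
  \<comment> \<open>By minimality the preceding power is still below \<open>v\<close>, so rounding
    up to a power costs at most the factor \<open>b\<close>.\<close>
  show "b ^ i \<le> b * v"
  proof (cases i)
    case 0
    then show ?thesis using assms by simp
  next
    case (Suc j)
    then show ?thesis using 2[of j] by simp
  qed
qed

lemma word_length_ge:
  assumes "k \<ge> 1" "0 < \<epsilon>" "\<epsilon> < 1"
  defines "u \<equiv> nat \<lceil>log 2 (real k / \<epsilon>)\<rceil>"
  shows "u \<ge> 1" "k \<le> 2 ^ u" "nat \<lceil>1 / \<epsilon>\<rceil> \<le> 2 ^ u"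
proof -
  have k_le: "real k \<le> real k / \<epsilon>" "1 / \<epsilon> \<le> real k / \<epsilon>" "1 < real k / \<epsilon>"
    using assms by (simp_all add: field_simps mult_left_le)
  then have "log 2 (real k / \<epsilon>) > 0" by simp
  then show "u \<ge> 1" unfolding u_def by linarith
  have "log 2 (real k / \<epsilon>) \<le> real u" unfolding u_def by linarith
  then have "real k / \<epsilon> \<le> 2 ^ u" using k_le by (simp add: log_le_iff powr_realpow)
  then have *: "real k \<le> 2 ^ u" "1 / \<epsilon> \<le> 2 ^ u" using k_le by linarith+
  show "k \<le> 2 ^ u" using *(1) by (metis of_nat_le_iff of_nat_numeral of_nat_power)
  have "\<lceil>1 / \<epsilon>\<rceil> \<le> 2 ^ u" using *(2) by (simp add: ceiling_le_iff)
  then show "nat \<lceil>1 / \<epsilon>\<rceil> \<le> 2 ^ u" by (simp add: nat_le_iff)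
qed

text \<open>With 27 <= 2^5 and e + 3 <= 2^(u + 2), the left side is at most 2 to the power 20 u +
  33. This exponent is less than 54 u because u >= 1.\<close>

lemma word_length_suffices:
  assumes "K \<le> u" "e \<le> u" "u \<ge> 1"
  shows "64 * (27 * (e + 3) * 4 ^ (e + 2) * 2 ^ K) * (4 ^ (K + (e + 2))) ^ 4 < (2::nat) ^ (54 * u)"
proof -
  have "e + 3 \<le> 2 ^ (e + 2)" using less_exp[of "e + 2"] by linarith
  also have "\<dots> \<le> (2::nat) ^ (u + 2)" using assms by (intro power_increasing) auto
  finally have e3: "e + 3 \<le> 2 ^ (u + 2)" .
  have four: "(4::nat) ^ i = 2 ^ (2 * i)" for i by (simp add: power_mult)
  have "64 * (27 * (e + 3) * 4 ^ (e + 2) * 2 ^ K) * (4 ^ (K + (e + 2))) ^ 4 \<le>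
      2 ^ 6 * (2 ^ 5 * 2 ^ (u + 2) * 2 ^ (2 * (u + 2)) * 2 ^ u) * (2 ^ (2 * (u + (u + 2)))) ^ (4::nat)"
    using assms e3 unfolding four by (intro mult_mono power_mono power_increasing) auto
  also have "\<dots> = 2 ^ (20 * u + 33)"
    by (simp flip: power_add power_mult) (simp add: power_add)
  also have "\<dots> < (2::nat) ^ (54 * u)" using assms by (intro power_strict_increasing) auto
  finally show ?thesis .
qed

text \<open>The constant is 108 * 36 * 256 * 4: 36 from e + 3 <= 5 + log 2 (1 / \<epsilon>) <= 6 l,
  256 from 2^e <= 4 / \<epsilon>, and 4 from rounding \<open>k\<close> up to a power of 4. The
  square of \<open>l\<close> is at most its fourth power, as l >= 1.\<close>

lemma sample_count_le:
  assumes k: "k \<ge> 1" and \<epsilon>: "0 < \<epsilon>" "\<epsilon> < 1"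
    and K: "4 ^ K \<le> 4 * k" and e: "2 ^ e \<le> 2 * nat \<lceil>1 / \<epsilon>\<rceil>"
  shows "108 * (real e + 3)\<^sup>2 * (4 ^ (e + 2) * 4 ^ K) \<le> 3981312 * sample_rate k \<epsilon>"
proof -
  define l where "l = max 1 (log 2 (1 / \<epsilon>))"
  have "(2::real) ^ e \<le> 2 * real (nat \<lceil>1 / \<epsilon>\<rceil>)"
    using e by (metis of_nat_le_iff of_nat_mult of_nat_numeral of_nat_power)
  also have "real (nat \<lceil>1 / \<epsilon>\<rceil>) \<le> 1 / \<epsilon> + 1" using \<epsilon> by (simp add: of_nat_ceiling)
  also have "2 * (1 / \<epsilon> + 1) \<le> 4 / \<epsilon>" using \<epsilon> by (simp add: field_simps)
  finally have e_le: "2 ^ e \<le> 4 / \<epsilon>" by simp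
  have "real e = log 2 (2 ^ e)" by simp
  also have "\<dots> \<le> log 2 (4 / \<epsilon>)" using e_le \<epsilon> by (intro log_mono) auto
  also have "\<dots> = log 2 (2 ^ 2) + log 2 (1 / \<epsilon>)" using \<epsilon> by (simp add: log_divide)
  also have "\<dots> = 2 + log 2 (1 / \<epsilon>)" by (subst log_nat_power) auto
  finally have "real e + 3 \<le> 6 * l" by (simp add: l_def)
  then have "(real e + 3)\<^sup>2 \<le> (6 * l)\<^sup>2" by (intro power_mono) auto
  also have "\<dots> = 36 * l ^ 2" by (simp add: power_mult_distrib)
  also have "\<dots> \<le> 36 * l ^ 4" by (intro mult_left_mono power_increasing) (auto simp: l_def)
  finally have el: "(real e + 3)\<^sup>2 \<le> 36 * l ^ 4" .
  have "(4::real) ^ e = (2 ^ e)\<^sup>2" by (simp add: power2_eq_square flip: power_mult_distrib)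
  also have "\<dots> \<le> (4 / \<epsilon>)\<^sup>2" using e_le by (intro power_mono) auto
  finally have e4: "(4::real) ^ (e + 2) \<le> 256 / \<epsilon>\<^sup>2" by (simp add: power_divide)
  have K4: "(4::real) ^ K \<le> 4 * real k"
    using K by (metis of_nat_le_iff of_nat_mult of_nat_numeral of_nat_power)
  have "108 * (real e + 3)\<^sup>2 * (4 ^ (e + 2) * 4 ^ K) \<le> 108 * (36 * l ^ 4) * (256 / \<epsilon>\<^sup>2 * (4 * real k))"
    using el e4 K4 by (intro mult_mono) (auto simp: l_def)
  also have "\<dots> = 3981312 * sample_rate k \<epsilon>" by (simp add: sample_rate_def l_def)
  finally show ?thesis .
qed

theorem theorem2:
  shows "\<exists>(P :: com) (m :: nat) (c :: nat) (C :: real).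
    working_memory P \<subseteq> {..<m} \<and> c > 0 \<and> C > 0 \<and>
    (\<forall>(k :: nat) (\<epsilon> :: real). k \<ge> 1 \<longrightarrow> 0 < \<epsilon> \<longrightarrow> \<epsilon> < 1 \<longrightarrow>
      (\<exists>(n :: nat) (b :: nat). real n \<le> C * sample_rate k \<epsilon> \<and>
        (\<forall>D :: nat pmf. set_pmf D \<subseteq> {1..k} \<longrightarrow>
          measure_pmf.prob (samples_and_coins n b D)
            {(xs, cs). \<exists>h. returns (word_length c k \<epsilon>) P k \<epsilon> xs cs h \<and>
                           \<bar>h - shannon_entropy k D\<bar> \<le> \<epsilon>} \<ge> 2 / 3)))"
\<comment> \<open>The program uses registers 0 to 19; the constants 54 and 3981312 come from
  \<open>word_length_suffices\<close> and \<open>sample_count_le\<close>.\<close>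
proof (rule exI[of _ entropy_program], rule exI[of _ 20], rule exI[of _ 54], rule exI[of _ 3981312],
    intro conjI allI impI)
  show "working_memory entropy_program \<subseteq> {..<20}"
    by (simp add: working_memory_def entropy_program_def scale_loop_def accuracy_loop_def
        parameter_assignments_def sample_loop_def repetition_loop_def level_loop_def logarithm_loop_def)
next
  fix k :: nat and \<epsilon> :: real assume k: "k \<ge> 1" and \<epsilon>: "0 < \<epsilon>" "\<epsilon> < 1"
  define N where "N = nat \<lceil>1 / \<epsilon>\<rceil>"
  define K where "K = (LEAST i. k \<le> 4 ^ i)"
  define e where "e = (LEAST i. N \<le> 2 ^ i)"
  define u where "u = nat \<lceil>log 2 (real k / \<epsilon>)\<rceil>"
  have "1 / \<epsilon> > 0" using \<epsilon> by simp
  then have N1: "N \<ge> 1" unfolding N_def by linarith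
  note u = word_length_ge[OF k \<epsilon>, folded u_def N_def]
  have "k \<le> 4 ^ u"
    using u(2) power_mono[of 2 "4::nat" u] by linarith
  then have "K \<le> u" unfolding K_def by (rule Least_le)
  moreover have "e \<le> u" unfolding e_def by (rule Least_le) (rule u(3))
  ultimately interpret parameters k N K e "word_length 54 k \<epsilon>"
    using Least_power_bounds[of 4 k] Least_power_bounds[of 2 N] N1 k word_length_suffices[of K u e] u(1)
    by unfold_locales (simp_all add: K_def e_def word_length_def u_def)
  show "\<exists>n b. real n \<le> 3981312 * sample_rate k \<epsilon> \<and>
      (\<forall>D :: nat pmf. set_pmf D \<subseteq> {1..k} \<longrightarrow>
        measure_pmf.prob (samples_and_coins n b D)
          {(xs, cs). \<exists>h. returns (word_length 54 k \<epsilon>) entropy_program k \<epsilon> xs cs h \<and>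
                         \<bar>h - shannon_entropy k D\<bar> \<le> \<epsilon>} \<ge> 2 / 3)"
  \<comment> \<open>The number of samples is fixed before the distribution is introduced. The
    program flips no coins, so none are supplied.\<close>
  proof (rule exI[of _ "total_length (levels 0)"], rule exI[of _ 0], intro conjI allI impI)
    have "real (total_length (levels 0)) \<le> 108 * (real e + 3)\<^sup>2 * (4 ^ d * 4 ^ K)"
      by (rule total_length_le)
    also have "\<dots> \<le> 3981312 * sample_rate k \<epsilon>"
      unfolding d_def using Least_power_bounds(3)[of 4 k] Least_power_bounds(3)[of 2 N] k N1
      by (intro sample_count_le k \<epsilon>) (simp_all add: K_def e_def N_def)
    finally show "real (total_length (levels 0)) \<le> 3981312 * sample_rate k \<epsilon>" .
  next
    fix D :: "nat pmf" assume D: "set_pmf D \<subseteq> {1..k}"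
    interpret estimation k N K e "word_length 54 k \<epsilon>" D \<epsilon>
      using D k \<epsilon> finite_subset[OF D] by unfold_locales (auto simp: N_def)
    show "2 / 3 \<le> measure_pmf.prob (samples_and_coins (total_length (levels 0)) 0 D)
        {(xs, cs). \<exists>h. returns (word_length 54 k \<epsilon>) entropy_program k \<epsilon> xs cs h \<and>
                       \<bar>h - shannon_entropy k D\<bar> \<le> \<epsilon>}"
      by (rule success_probability) (simp add: N_def)
  qed
qed simp_all

end
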